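(* Let $\xi: Z\overset{j}{\to}X\overset{f}{\to}Y$ be a fibration. For any $n$, the sequences $$\pi_{n+1}(Y)\overset{\partial_{n+1}}{\to}\pi_n(Z)\overset{\pi_n(j)}{\to}\mathcal{G}_n(X,Z;j)\overset{\pi_n(f)}{\to}\pi_n(Y)$$ and $$\pi_n(Z)\overset{\pi_n(j)}{\to}\pi_n(X)\overset{\pi_n(f)}{\to}\mathcal{G}_n(Y,X;f)\overset{\partial_n}{\to}\pi_{n-1}(Z)$$ (that is, the indicated maps take values in the indicated subgroups) are both exact. Moreover, for the connecting map $\tilde\partial:\Omega Y\to Z$ of $\xi$, the sequence $$\pi_{n+1}(X)\overset{\pi_{n+1}(f)}{\to}\pi_{n+1}(Y)\overset{\partial_{n+1}}{\to}\mathcal{G}_n(Z,\Omega Y;\tilde\partial)\overset{\pi_n(j)}{\to}\pi_n(X)$$ is exact.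
   Context: $Z,X,Y$ are (of the homotopy type of) connected CW complexes, $n\ge 1$, and maps and homotopies are pointed. $\partial_{k}:\pi_{k}(Y)\to\pi_{k-1}(Z)$ is the connecting homomorphism of the long exact homotopy sequence of $\xi$; under $\pi_n(\Omega Y)\cong\pi_{n+1}(Y)$ it is induced by $\tilde\partial$. For spaces $B,X$ let $i_X:X\to B\times X$, $i_X(x)=( *,x)$, and let $p_B:B\times X\to B$ be the projection; a section is a map $s:B\to B\times X$ with $p_B\circ s\simeq \mathrm{id}_B$. For a pointed map $f:X\to Y$, the $n$th relaxed evaluation subgroup $\mathcal{G}_n(Y,X;f)$ is the set of all $a\in\pi_n(Y)$ for which there exist a section $s:S^n\to S^n\times X$ and a map $F:S^n\times X\to Y$ such that $F\circ s\simeq a$ and $F\circ i_X\simeq f$. The same definition is used for any pointed map, e.g. $j:Z\to X$ and $\tilde\partial:\Omega Y\to Z$. *)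

theory Defs
  imports "HOL-Analysis.Analysis" "HOL-Algebra.Coset"
begin

section \<open>Pointed maps and pointed homotopies\<close>

text \<open>A pointed space is given by a topology together with a point of its underlying set.\<close>

definition pointed_map :: "'a topology \<Rightarrow> 'a \<Rightarrow> 'b topology \<Rightarrow> 'b \<Rightarrow> ('a \<Rightarrow> 'b) \<Rightarrow> bool"
  where "pointed_map X x0 Y y0 f \<longleftrightarrow> continuous_map X Y f \<and> f x0 = y0"

text \<open>Since \<open>x0\<close> lies in \<open>X\<close>, only the values on \<^term>\<open>topspace X\<close> matter; the relation implies
  that \<open>f\<close> and \<open>g\<close> are pointed maps.\<close>

definition pointed_homotopic ::
    "'a topology \<Rightarrow> 'a \<Rightarrow> 'b topology \<Rightarrow> 'b \<Rightarrow> ('a \<Rightarrow> 'b) \<Rightarrow> ('a \<Rightarrow> 'b) \<Rightarrow> bool"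
  where "pointed_homotopic X x0 Y y0 f g \<longleftrightarrow> homotopic_with (\<lambda>h. h x0 = y0) X Y f g"


section \<open>CW complexes\<close>

definition closed_disc :: "nat \<Rightarrow> (nat \<Rightarrow> real) topology"
  where "closed_disc n = subtopology (Euclidean_space n) {v. (\<Sum>i<n. (v i)\<^sup>2) \<le> 1}"

definition disc_interior :: "nat \<Rightarrow> (nat \<Rightarrow> real) set"
  where "disc_interior n = {v \<in> topspace (closed_disc n). (\<Sum>i<n. (v i)\<^sup>2) < 1}"

definition disc_boundary :: "nat \<Rightarrow> (nat \<Rightarrow> real) set"
  where "disc_boundary n = {v \<in> topspace (closed_disc n). (\<Sum>i<n. (v i)\<^sup>2) = 1}"

text \<open>A cell is a pair of its dimension and its characteristic map.\<close>

definition open_cell :: "nat \<times> ((nat \<Rightarrow> real) \<Rightarrow> 'a) \<Rightarrow> 'a set"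
  where "open_cell c = snd c ` disc_interior (fst c)"

definition closed_cell :: "nat \<times> ((nat \<Rightarrow> real) \<Rightarrow> 'a) \<Rightarrow> 'a set"
  where "closed_cell c = snd c ` topspace (closed_disc (fst c))"

definition cw_structure :: "'a topology \<Rightarrow> (nat \<times> ((nat \<Rightarrow> real) \<Rightarrow> 'a)) set \<Rightarrow> bool"
  where "cw_structure X C \<longleftrightarrow>
    Hausdorff_space X \<and>
    (\<forall>(n, \<Phi>) \<in> C. continuous_map (closed_disc n) X \<Phi> \<and>
       embedding_map (subtopology (closed_disc n) (disc_interior n)) X \<Phi>) \<and>
    (\<forall>x \<in> topspace X. \<exists>!c. c \<in> C \<and> x \<in> open_cell c) \<and>
    (\<forall>(n, \<Phi>) \<in> C. \<exists>E \<subseteq> C. finite E \<and> (\<forall>e \<in> E. fst e < n) \<and>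
       \<Phi> ` disc_boundary n \<subseteq> (\<Union>e \<in> E. open_cell e)) \<and>
    (\<forall>A \<subseteq> topspace X. (\<forall>c \<in> C. closedin X (A \<inter> closed_cell c)) \<longrightarrow> closedin X A)"

definition CW_complex :: "'a topology \<Rightarrow> bool"
  where "CW_complex X \<longleftrightarrow> (\<exists>C. cw_structure X C)"


section \<open>Spheres and homotopy groups\<close>

definition sphere_base :: "nat \<Rightarrow> real"
  where "sphere_base = (\<lambda>i. if i = 0 then 1 else 0)"

text \<open>The quotient map from \<open>S\<^sup>n \<times> [0,1]\<close> onto the reduced suspension \<open>S\<^sup>n\<^sup>+\<^sup>1\<close> of \<open>S\<^sup>n\<close>: with \<open>e\<close> the
  base point, \<open>t \<mapsto> sphere_susp n s t\<close> runs once through the circle with diameter from \<open>e\<close> to \<open>s\<close>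
  parallel to the new coordinate axis,
  \<open>(e + s)/2 + cos (2 \<pi> t) (e - s)/2 + sin (2 \<pi> t) (norm (e - s)/2) e\<^sub>n\<^sub>+\<^sub>1\<close>,
  starting and ending at \<open>e\<close>. Note that \<open>(norm (e - s)/2)\<^sup>2 = (1 - s 0)/2\<close>.\<close>

definition sphere_susp :: "nat \<Rightarrow> (nat \<Rightarrow> real) \<Rightarrow> real \<Rightarrow> nat \<Rightarrow> real"
  where "sphere_susp n s t = (\<lambda>i.
    if i = Suc n then sin (2 * pi * t) * sqrt ((1 - s 0) / 2)
    else (sphere_base i + s i) / 2 + cos (2 * pi * t) * ((sphere_base i - s i) / 2))"

definition cube :: "nat \<Rightarrow> (nat \<Rightarrow> real) set"
  where "cube n = {u. (\<forall>i<n. u i \<in> {0..1}) \<and> (\<forall>i\<ge>n. u i = 0)}"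

text \<open>The iterated suspension coordinates identify \<open>S\<^sup>n\<close> with the cube modulo its boundary
  (for \<open>n = 0\<close> the single point of the cube goes to the point of \<open>S\<^sup>0\<close> that is not the base point).\<close>

primrec cube_to_sphere :: "nat \<Rightarrow> (nat \<Rightarrow> real) \<Rightarrow> nat \<Rightarrow> real"
  where
    "cube_to_sphere 0 u = (\<lambda>i. - sphere_base i)"
  | "cube_to_sphere (Suc n) u = sphere_susp n (cube_to_sphere n u) (u n)"

definition sphere_class :: "nat \<Rightarrow> 'a topology \<Rightarrow> 'a \<Rightarrow> ((nat \<Rightarrow> real) \<Rightarrow> 'a) \<Rightarrow> ((nat \<Rightarrow> real) \<Rightarrow> 'a) set"
  where "sphere_class n Y y0 a = {g. pointed_homotopic (nsphere n) sphere_base Y y0 a g}"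

text \<open>\<open>c\<close> is the concatenation of \<open>a\<close> and \<open>b\<close> along the first coordinate of the cube.\<close>

definition is_concat ::
    "nat \<Rightarrow> ((nat \<Rightarrow> real) \<Rightarrow> 'a) \<Rightarrow> ((nat \<Rightarrow> real) \<Rightarrow> 'a) \<Rightarrow> ((nat \<Rightarrow> real) \<Rightarrow> 'a) \<Rightarrow> bool"
  where "is_concat n a b c \<longleftrightarrow> (\<forall>u \<in> cube n. c (cube_to_sphere n u) =
    (if u 0 \<le> 1/2 then a (cube_to_sphere n (u(0 := 2 * u 0)))
     else b (cube_to_sphere n (u(0 := 2 * u 0 - 1)))))"

text \<open>\<open>\<pi>\<^sub>n(Y, y0)\<close>: the pointed homotopy classes of pointed maps \<open>S\<^sup>n \<rightarrow> Y\<close>. For \<open>n = 0\<close> this is the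
  pointed set of path components and the multiplication has no meaning (unless \<open>Y\<close> is path connected
  and \<open>\<pi>\<^sub>0\<close> is the trivial group).\<close>

definition homotopy_group :: "nat \<Rightarrow> 'a topology \<Rightarrow> 'a \<Rightarrow> ((nat \<Rightarrow> real) \<Rightarrow> 'a) set monoid"
  where "homotopy_group n Y y0 =
    \<lparr>carrier = sphere_class n Y y0 ` {a. pointed_map (nsphere n) sphere_base Y y0 a},
     mult = (\<lambda>A B. {g. \<exists>a \<in> A. \<exists>b \<in> B. \<exists>c. is_concat n a b c \<and> g \<in> sphere_class n Y y0 c}),
     one = sphere_class n Y y0 (\<lambda>_. y0)\<rparr>"

text \<open>\<open>\<pi>\<^sub>n(f)\<close> for \<open>f : X \<rightarrow> Y\<close>, that is, \<open>[a] \<mapsto> [f \<circ> a]\<close>.\<close>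

definition homotopy_group_map ::
    "nat \<Rightarrow> 'b topology \<Rightarrow> 'b \<Rightarrow> ('a \<Rightarrow> 'b) \<Rightarrow> ((nat \<Rightarrow> real) \<Rightarrow> 'a) set \<Rightarrow> ((nat \<Rightarrow> real) \<Rightarrow> 'b) set"
  where "homotopy_group_map n Y y0 f A = (\<Union>a \<in> A. sphere_class n Y y0 (f \<circ> a))"


section \<open>Path spaces and loop spaces\<close>

definition paths :: "'a topology \<Rightarrow> (real \<Rightarrow> 'a) set"
  where "paths Y = {\<gamma> \<in> extensional {0..1}. pathin Y \<gamma>}"

text \<open>The space of paths \<open>[0,1] \<rightarrow> Y\<close> with the compact-open topology.\<close>

definition path_space :: "'a topology \<Rightarrow> (real \<Rightarrow> 'a) topology"
  where "path_space Y = topology_generated_by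
    {{\<gamma> \<in> paths Y. \<gamma> ` K \<subseteq> U} | K U. compact K \<and> K \<subseteq> {0..1} \<and> openin Y U}"

definition const_path :: "'a \<Rightarrow> real \<Rightarrow> 'a"
  where "const_path y0 = (\<lambda>t\<in>{0..1}. y0)"

definition loop_space :: "'a topology \<Rightarrow> 'a \<Rightarrow> (real \<Rightarrow> 'a) topology"
  where "loop_space Y y0 = subtopology (path_space Y) {\<gamma>. \<gamma> 0 = y0 \<and> \<gamma> 1 = y0}"


section \<open>Fibrations\<close>

text \<open>Hurewicz fibrations: the homotopy lifting property for all spaces \<open>W\<close>. A formula cannot quantify
  over the type of points of \<open>W\<close>, but this is no restriction: with the type below, \<open>W\<close> may be
  the space of all pairs \<open>(x, \<gamma>)\<close> with \<open>\<gamma>\<close> a path in \<open>Y\<close> from \<open>f x\<close>, and every lifting problem, over a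
  space of any type, is pulled back from the evaluation homotopy on this space.\<close>

definition hurewicz_fibration :: "'a topology \<Rightarrow> 'b topology \<Rightarrow> ('a \<Rightarrow> 'b) \<Rightarrow> bool"
  where "hurewicz_fibration X Y f \<longleftrightarrow> continuous_map X Y f \<and>
    (\<forall>(W :: ('a \<times> (real \<Rightarrow> 'b)) topology) g h.
       continuous_map W X g \<and>
       continuous_map (prod_topology (top_of_set {0..1::real}) W) Y h \<and>
       (\<forall>w \<in> topspace W. h (0, w) = f (g w)) \<longrightarrow>
       (\<exists>H. continuous_map (prod_topology (top_of_set {0..1::real}) W) X H \<and>
            (\<forall>w \<in> topspace W. H (0, w) = g w) \<and>
            (\<forall>t \<in> {0..1}. \<forall>w \<in> topspace W. f (H (t, w)) = h (t, w))))"

text \<open>\<open>Z \<rightarrow> X \<rightarrow> Y\<close> is a fibration with fibre \<open>Z\<close>: \<open>j\<close> is a homeomorphism onto the fibre of \<open>f\<close>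
  over the base point.\<close>

definition fibration_sequence ::
    "'z topology \<Rightarrow> 'z \<Rightarrow> ('z \<Rightarrow> 'x) \<Rightarrow> 'x topology \<Rightarrow> 'x \<Rightarrow> ('x \<Rightarrow> 'y) \<Rightarrow> 'y topology \<Rightarrow> 'y \<Rightarrow> bool"
  where "fibration_sequence Z z0 j X x0 f Y y0 \<longleftrightarrow>
    z0 \<in> topspace Z \<and> x0 \<in> topspace X \<and> y0 \<in> topspace Y \<and>
    pointed_map Z z0 X x0 j \<and> pointed_map X x0 Y y0 f \<and>
    hurewicz_fibration X Y f \<and>
    embedding_map Z X j \<and> j ` topspace Z = {x \<in> topspace X. f x = y0}"

text \<open>\<open>\<partial>\<^sub>k : \<pi>\<^sub>k(Y) \<rightarrow> \<pi>\<^sub>k\<^sub>-\<^sub>1(Z)\<close> for \<open>k \<ge> 1\<close>: regard \<open>a : S\<^sup>k \<rightarrow> Y\<close> as a homotopy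
  \<open>S\<^sup>k\<^sup>-\<^sup>1 \<times> [0,1] \<rightarrow> Y\<close>, lift it to a pointed homotopy \<open>H\<close> starting at the constant map, and
  take the class of the end of \<open>H\<close>, which has values in the fibre.\<close>

definition connecting_hom ::
    "nat \<Rightarrow> 'z topology \<Rightarrow> 'z \<Rightarrow> ('z \<Rightarrow> 'x) \<Rightarrow> 'x topology \<Rightarrow> 'x \<Rightarrow> ('x \<Rightarrow> 'y) \<Rightarrow>
     ((nat \<Rightarrow> real) \<Rightarrow> 'y) set \<Rightarrow> ((nat \<Rightarrow> real) \<Rightarrow> 'z) set"
  where "connecting_hom k Z z0 j X x0 f A =
    {g. \<exists>a \<in> A. \<exists>H z.
       continuous_map (prod_topology (top_of_set {0..1::real}) (nsphere (k - 1))) X H \<and>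
       (\<forall>s \<in> topspace (nsphere (k - 1)). H (0, s) = x0) \<and>
       (\<forall>t \<in> {0..1}. H (t, sphere_base) = x0) \<and>
       (\<forall>t \<in> {0..1}. \<forall>s \<in> topspace (nsphere (k - 1)).
          f (H (t, s)) = a (sphere_susp (k - 1) s t)) \<and>
       pointed_map (nsphere (k - 1)) sphere_base Z z0 z \<and>
       (\<forall>s \<in> topspace (nsphere (k - 1)). j (z s) = H (1, s)) \<and>
       g \<in> sphere_class (k - 1) Z z0 z}"

definition homotopy_fibre :: "'x topology \<Rightarrow> ('x \<Rightarrow> 'y) \<Rightarrow> 'y topology \<Rightarrow> 'y \<Rightarrow> ('x \<times> (real \<Rightarrow> 'y)) topology"
  where "homotopy_fibre X f Y y0 =
    subtopology (prod_topology X (path_space Y)) {(x, \<gamma>). \<gamma> 0 = f x \<and> \<gamma> 1 = y0}"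

text \<open>The connecting map \<open>\<Omega>Y \<rightarrow> Z\<close> is determined up to pointed homotopy: it corresponds to the
  inclusion \<open>\<omega> \<mapsto> (x0, \<omega>)\<close> of \<open>\<Omega>Y\<close> into the homotopy fibre of \<open>f\<close> under the canonical equivalence
  \<open>z \<mapsto> (j z, const)\<close> from the fibre to the homotopy fibre.\<close>

definition connecting_map ::
    "'z topology \<Rightarrow> 'z \<Rightarrow> ('z \<Rightarrow> 'x) \<Rightarrow> 'x topology \<Rightarrow> 'x \<Rightarrow> ('x \<Rightarrow> 'y) \<Rightarrow> 'y topology \<Rightarrow> 'y \<Rightarrow>
     ((real \<Rightarrow> 'y) \<Rightarrow> 'z) \<Rightarrow> bool"
  where "connecting_map Z z0 j X x0 f Y y0 d \<longleftrightarrow>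
    pointed_map (loop_space Y y0) (const_path y0) Z z0 d \<and>
    pointed_homotopic (loop_space Y y0) (const_path y0)
      (homotopy_fibre X f Y y0) (x0, const_path y0)
      (\<lambda>\<omega>. (j (d \<omega>), const_path y0)) (\<lambda>\<omega>. (x0, \<omega>))"


section \<open>Relaxed evaluation subgroups\<close>

definition is_section :: "'b topology \<Rightarrow> 'b \<Rightarrow> 'a topology \<Rightarrow> 'a \<Rightarrow> ('b \<Rightarrow> 'b \<times> 'a) \<Rightarrow> bool"
  where "is_section B b0 X x0 s \<longleftrightarrow>
    pointed_map B b0 (prod_topology B X) (b0, x0) s \<and>
    pointed_homotopic B b0 B b0 (fst \<circ> s) id"

text \<open>\<open>\<G>\<^sub>n(Y, X; f)\<close>. An element \<open>A\<close> of \<open>\<pi>\<^sub>n(Y)\<close> is a full homotopy class, so \<open>F \<circ> s \<in> A\<close> says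
  that \<open>F \<circ> s\<close> represents \<open>A\<close>.\<close>

definition relaxed_evaluation_set ::
    "nat \<Rightarrow> 'b topology \<Rightarrow> 'b \<Rightarrow> 'a topology \<Rightarrow> 'a \<Rightarrow> ('a \<Rightarrow> 'b) \<Rightarrow> ((nat \<Rightarrow> real) \<Rightarrow> 'b) set set"
  where "relaxed_evaluation_set n Y y0 X x0 f =
    {A \<in> carrier (homotopy_group n Y y0). \<exists>s F.
       is_section (nsphere n) sphere_base X x0 s \<and>
       pointed_map (prod_topology (nsphere n) X) (sphere_base, x0) Y y0 F \<and>
       F \<circ> s \<in> A \<and>
       pointed_homotopic X x0 Y y0 (F \<circ> (\<lambda>x. (sphere_base, x))) f}"

definition relaxed_evaluation_group ::
    "nat \<Rightarrow> 'b topology \<Rightarrow> 'b \<Rightarrow> 'a topology \<Rightarrow> 'a \<Rightarrow> ('a \<Rightarrow> 'b) \<Rightarrow> ((nat \<Rightarrow> real) \<Rightarrow> 'b) set monoid"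
  where "relaxed_evaluation_group n Y y0 X x0 f =
    (homotopy_group n Y y0)\<lparr>carrier := relaxed_evaluation_set n Y y0 X x0 f\<rparr>"


section \<open>Exact sequences\<close>

text \<open>The library's \<open>exact_seq\<close> needs all groups to have elements of the same type. Here the
  homomorphism conditions include that the arrows take values in the indicated carriers.\<close>

definition exact_four ::
    "'a monoid \<Rightarrow> ('a \<Rightarrow> 'b) \<Rightarrow> 'b monoid \<Rightarrow> ('b \<Rightarrow> 'c) \<Rightarrow> 'c monoid \<Rightarrow> ('c \<Rightarrow> 'd) \<Rightarrow> 'd monoid \<Rightarrow> bool"
  where "exact_four G0 h0 G1 h1 G2 h2 G3 \<longleftrightarrow>
    h0 \<in> hom G0 G1 \<and> h1 \<in> hom G1 G2 \<and> h2 \<in> hom G2 G3 \<and>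
    h0 ` carrier G0 = kernel G1 G2 h1 \<and>
    h1 ` carrier G1 = kernel G2 G3 h2"

end

theory Submission
  imports Defs
begin

text \<open>
  The three sequences are the long exact homotopy sequence of the fibration, with one group replaced
  by a relaxed evaluation subgroup. So there are two things to see.

  The subgroup contains the image of the arrow that enters it. For pointed maps \<open>d : W \<rightarrow> V\<close> and
  \<open>k : S\<^sup>n \<rightarrow> W\<close>, the section \<open>s \<mapsto> (s, k s)\<close> and the map \<open>(s, w) \<mapsto> d w\<close> show that \<open>d \<circ> k\<close> represents
  an element of \<open>\<G>\<^sub>n(V, W; d)\<close>: a relaxed evaluation subgroup contains the image of \<open>\<pi>\<^sub>n(d)\<close>
  (\<open>postcomposition_in_relaxed_evaluation_set\<close>). This covers \<open>\<pi>\<^sub>n(j)\<close> and \<open>\<pi>\<^sub>n(f)\<close>, and also the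
  connecting homomorphism, since the boundary of \<open>[a]\<close> is represented by the composition of the
  connecting map with the adjoint \<open>S\<^sup>n \<rightarrow> \<Omega>Y\<close> of \<open>a\<close> (\<open>connecting_hom_eq_connecting_map\<close>). Replacing a
  group by a subset that contains the image of the entering arrow changes neither this image nor
  the kernel that it equals (\<open>exact_four_corestrict\<close>).

  The long sequence itself is exact. Here everything about the boundary of a class is read off
  from the homotopy fibre: the boundary of \<open>[a]\<close> is \<open>[g]\<close> if and only if
  \<open>s \<mapsto> (j (g s), const)\<close> and \<open>s \<mapsto> (x0, adjoint of a at s)\<close> are homotopic as pointed maps into the
  homotopy fibre (\<open>connecting_hom_eq_class_iff\<close>). This rests on the fact that the inclusion of the
  fibre into the homotopy fibre reflects pointed homotopies (\<open>fibre_inclusion_reflects_homotopy\<close>),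
  which in turn needs lifts that stand still where a given function vanishes and the homotopy to
  be lifted is constant (\<open>hurewicz_fibration_lift_stationary\<close>): they keep base points and prescribed ends fixed.
  Exactness at \<open>\<pi>\<^sub>n(Z)\<close> and \<open>\<pi>\<^sub>n(X)\<close> then only unfolds what a lift is; for exactness at the homotopy
  groups of \<open>Y\<close> a null homotopy in the homotopy fibre is a family of squares in \<open>Y\<close> that is swept out to deform
  \<open>a\<close> into \<open>f \<circ> b\<close> (\<open>null_boundary_lifts\<close>).

  The arrows are homomorphisms because concatenation is the composition with a pinch map
  \<open>S\<^sup>n \<rightarrow> S\<^sup>n \<or> S\<^sup>n\<close>. It commutes with maps of the target, and the pinch map of \<open>S\<^sup>n\<^sup>+\<^sup>1\<close> is the suspension
  of that of \<open>S\<^sup>n\<close>, so the concatenation of two lifts is a lift of the concatenation. This leaves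
  \<open>\<pi>\<^sub>1(Y) \<rightarrow> \<pi>\<^sub>0(Z)\<close>, whose target is a point since a connected space of the homotopy type of a CW
  complex is path connected (\<open>path_connected_of_CW_homotopy_type\<close>).
\<close>

section \<open>Spheres as iterated suspensions\<close>

abbreviation interval :: "real topology"
  where "interval \<equiv> top_of_set {0..1}"

lemma in_nsphere_iff:
  "s \<in> topspace (nsphere n) \<longleftrightarrow> (\<forall>i>n. s i = 0) \<and> (s 0)\<^sup>2 + (\<Sum>i\<in>{1..n}. (s i)\<^sup>2) = 1"
proof -
  have "{..n} = insert 0 {1..n}" by auto
  then have "(\<Sum>i\<le>n. (s i)\<^sup>2) = (s 0)\<^sup>2 + (\<Sum>i\<in>{1..n}. (s i)\<^sup>2)" by simp
  then show ?thesis by (auto simp: nsphere)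
qed

lemma sphere_base_in_nsphere [simp]: "sphere_base \<in> topspace (nsphere n)"
  by (simp add: in_nsphere_iff sphere_base_def)

lemma nsphere_coord0:
  assumes "s \<in> topspace (nsphere n)"
  shows "- 1 \<le> s 0" "s 0 \<le> 1"
proof -
  have "0 \<le> (\<Sum>i\<in>{1..n}. (s i)\<^sup>2)" by (simp add: sum_nonneg)
  then have "(s 0)\<^sup>2 \<le> 1" using assms by (simp add: in_nsphere_iff)
  then have "\<bar>s 0\<bar> \<le> 1" by (simp add: abs_square_le_1)
  then show "- 1 \<le> s 0" "s 0 \<le> 1" by auto
qed

lemma nsphere_eq_base_iff:
  assumes "s \<in> topspace (nsphere n)"
  shows "s = sphere_base \<longleftrightarrow> s 0 = 1"
proof
  assume 1: "s 0 = 1"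
  then have "(\<Sum>i\<in>{1..n}. (s i)\<^sup>2) = 0" using assms by (simp add: in_nsphere_iff)
  then have "\<forall>i\<in>{1..n}. (s i)\<^sup>2 = 0" by (subst (asm) sum_nonneg_eq_0_iff) auto
  then have "s i = 0" if "i > 0" for i
    using assms that by (cases "i \<le> n") (auto simp: in_nsphere_iff)
  then show "s = sphere_base" using 1 by (auto simp: sphere_base_def fun_eq_iff)
qed (simp add: sphere_base_def)

lemma sphere_susp_simps:
  "sphere_susp n s t 0 = 1 - (1 - cos (2 * pi * t)) * ((1 - s 0) / 2)"
  "1 \<le> i \<Longrightarrow> i \<le> n \<Longrightarrow> sphere_susp n s t i = (1 - cos (2 * pi * t)) / 2 * s i"
  "sphere_susp n s t (Suc n) = sin (2 * pi * t) * sqrt ((1 - s 0) / 2)"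
  by (auto simp: sphere_susp_def sphere_base_def field_simps)

lemma sphere_susp_base [simp]: "sphere_susp n sphere_base t = sphere_base"
  by (auto simp: sphere_susp_def sphere_base_def fun_eq_iff)

lemma sphere_susp_ends [simp]: "sphere_susp n s 0 = sphere_base" "sphere_susp n s 1 = sphere_base"
  by (auto simp: sphere_susp_def sphere_base_def fun_eq_iff field_simps)

lemma sphere_susp_in_nsphere:
  assumes s: "s \<in> topspace (nsphere n)"
  shows "sphere_susp n s t \<in> topspace (nsphere (Suc n))"
proof -
  let ?p = "sphere_susp n s t" and ?c = "cos (2 * pi * t)" and ?T = "\<Sum>i\<in>{1..n}. (s i)\<^sup>2"
  have T: "?T = 1 - (s 0)\<^sup>2" using s by (simp add: in_nsphere_iff)
  have "(\<Sum>i\<in>{1..n}. (?p i)\<^sup>2) = (\<Sum>i\<in>{1..n}. ((1 - ?c) / 2)\<^sup>2 * (s i)\<^sup>2)"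
    by (rule sum.cong) (auto simp: sphere_susp_simps power_mult_distrib power_divide)
  also have "\<dots> = ((1 - ?c) / 2)\<^sup>2 * ?T" by (simp add: sum_distrib_left)
  finally have 1: "(\<Sum>i\<in>{1..n}. (?p i)\<^sup>2) = ((1 - ?c) / 2)\<^sup>2 * (1 - (s 0)\<^sup>2)" by (simp only: T)
  have 2: "(?p (Suc n))\<^sup>2 = (1 - ?c\<^sup>2) * ((1 - s 0) / 2)"
    using nsphere_coord0[OF s] by (simp add: sphere_susp_simps power_mult_distrib sin_squared_eq)
  have "(?p 0)\<^sup>2 + (((1 - ?c) / 2)\<^sup>2 * (1 - (s 0)\<^sup>2) + (1 - ?c\<^sup>2) * ((1 - s 0) / 2)) = 1"
    unfolding sphere_susp_simps by (simp add: field_simps power2_eq_square)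
  moreover have "?p i = 0" if "i > Suc n" for i
    using that s by (auto simp: sphere_susp_def sphere_base_def in_nsphere_iff)
  ultimately show ?thesis
    unfolding in_nsphere_iff using 1 2 by simp
qed

lemma continuous_map_sphere_susp:
  "continuous_map (prod_topology interval (nsphere n)) (nsphere (Suc n))
     (\<lambda>(t, s). sphere_susp n s t)"
proof -
  let ?W = "prod_topology interval (nsphere n)"
  have fst: "continuous_map ?W euclideanreal fst"
    by (metis continuous_map_fst continuous_map_into_fulltopology)
  have snd: "continuous_map ?W euclideanreal (\<lambda>w. snd w i)" for i
    using continuous_map_compose[OF continuous_map_snd continuous_map_nsphere_projection]
    by (simp add: o_def)
  have trig: "continuous_map ?W euclideanreal (\<lambda>w. g (2 * pi * fst w))"
    if "continuous_on UNIV g" for g :: "real \<Rightarrow> real"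
  proof -
    have "continuous_map ?W euclideanreal (g \<circ> (\<lambda>w. 2 * pi * fst w))"
      by (rule continuous_map_compose[where X' = euclideanreal])
        (auto intro!: continuous_intros fst that simp: fst)
    then show ?thesis by (simp add: o_def)
  qed
  have root: "continuous_map ?W euclideanreal (\<lambda>w. sqrt ((1 - snd w 0) / 2))"
  proof -
    have "continuous_map ?W euclideanreal (sqrt \<circ> (\<lambda>w. (1 - snd w 0) / 2))"
      by (rule continuous_map_compose[where X' = euclideanreal])
        (auto intro!: continuous_intros snd)
    then show ?thesis by (simp add: o_def)
  qed
  have "continuous_map ?W euclideanreal (\<lambda>w. sphere_susp n (snd w) (fst w) i)" for i
    unfolding sphere_susp_def
    by (cases "i = Suc n")
      (auto intro!: continuous_intros snd trig root continuous_on_sin continuous_on_cos)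
  then have "continuous_map ?W (powertop_real UNIV) (\<lambda>(t, s). sphere_susp n s t)"
    by (simp add: continuous_map_componentwise_UNIV case_prod_unfold)
  then show ?thesis
    using sphere_susp_in_nsphere
    by (auto simp: nsphere continuous_map_in_subtopology)
qed

text \<open>Stereographic projection from the base point turns \<open>sphere_susp n s t\<close> into the pair of the
  projection of \<open>s\<close> and one further coordinate. So away from the base point \<open>s\<close> is determined, and
  then so are \<open>cos (2 \<pi> t)\<close> and \<open>sin (2 \<pi> t)\<close>.\<close>

lemma sphere_susp_inj:
  assumes s: "s \<in> topspace (nsphere n)" and s': "s' \<in> topspace (nsphere n)"
    and t: "t \<in> {0..1}" and t': "t' \<in> {0..1}"
    and eq: "sphere_susp n s t = sphere_susp n s' t'" and ne: "sphere_susp n s t \<noteq> sphere_base"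
  shows "s = s' \<and> t = t'"
proof -
  define c where "c = cos (2 * pi * t)"
  define c' where "c' = cos (2 * pi * t')"
  let ?p = "sphere_susp n s t"
  have p: "?p \<in> topspace (nsphere (Suc n))" by (rule sphere_susp_in_nsphere[OF s])
  have "?p 0 \<noteq> 1" using ne nsphere_eq_base_iff[OF p] by simp
  then have c1: "c \<noteq> 1" "s 0 \<noteq> 1" by (auto simp: sphere_susp_simps c_def)
  have e0: "(1 - c) * (1 - s 0) = (1 - c') * (1 - s' 0)"
    using fun_cong[OF eq, of 0] by (simp add: sphere_susp_simps c_def c'_def)
  then have c1': "c' \<noteq> 1" "s' 0 \<noteq> 1" using c1 by auto
  have ei: "(1 - c) * s i = (1 - c') * s' i" if "i \<in> {1..n}" for i
    using fun_cong[OF eq, of i] that by (simp add: sphere_susp_simps c_def c'_def)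
  have T: "(\<Sum>i\<in>{1..n}. (s i)\<^sup>2) = 1 - (s 0)\<^sup>2" "(\<Sum>i\<in>{1..n}. (s' i)\<^sup>2) = 1 - (s' 0)\<^sup>2"
    using s s' by (simp_all add: in_nsphere_iff)
  have "(1 - c)\<^sup>2 * (\<Sum>i\<in>{1..n}. (s i)\<^sup>2) = (1 - c')\<^sup>2 * (\<Sum>i\<in>{1..n}. (s' i)\<^sup>2)"
    unfolding sum_distrib_left
    by (rule sum.cong) (use ei in \<open>auto simp flip: power_mult_distrib\<close>)
  then have "((1 - c) * (1 - s 0)) * ((1 - c) * (1 + s 0))
      = ((1 - c') * (1 - s' 0)) * ((1 - c') * (1 + s' 0))"
    unfolding T by (simp add: power2_eq_square algebra_simps)
  then have "(1 - c) * (1 + s 0) = (1 - c') * (1 + s' 0)"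
    using e0 c1 c1' by simp
  then have "c = c'" using e0 by (simp add: algebra_simps)
  moreover have "s 0 = s' 0" using e0 c1 \<open>c = c'\<close> by simp
  moreover have "s i = s' i" if "i \<noteq> 0" for i
    using that s s' ei[of i] \<open>c = c'\<close> c1 by (cases "i \<le> n") (auto simp: in_nsphere_iff)
  ultimately have ss: "s = s'" by (metis ext)
  have "s 0 < 1" using nsphere_coord0[OF s] c1 by simp
  then have "sqrt ((1 - s 0) / 2) \<noteq> 0" by simp
  then have sn: "sin (2 * pi * t) = sin (2 * pi * t')"
    using fun_cong[OF eq, of "Suc n"] ss by (simp add: sphere_susp_simps)
  have strict: "u \<in> {0<..<1}" if "u \<in> {0..1}" "cos (2 * pi * u) \<noteq> 1" for u
  proof -
    have "u \<noteq> 0" "u \<noteq> 1" using that(2) by auto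
    then show ?thesis using that(1) by auto
  qed
  have "t \<in> {0<..<1}" "t' \<in> {0<..<1}"
    using strict t t' c1 c1' by (auto simp: c_def c'_def)
  moreover obtain k :: int where "2 * pi * t = 2 * pi * t' + 2 * pi * k"
    using sn \<open>c = c'\<close> sin_cos_eq_iff[of "2 * pi * t" "2 * pi * t'"] by (auto simp: c_def c'_def)
  then have "2 * pi * t = 2 * pi * (t' + k)" by (simp add: algebra_simps)
  then have "t = t' + k" by simp
  ultimately have "\<bar>real_of_int k\<bar> < 1" by auto
  then have "k = 0" by linarith
  then show ?thesis using \<open>t = t' + k\<close> ss by simp
qed

text \<open>The point \<open>s\<close> is the inverse stereographic projection of \<open>p\<close> without its last coordinate; then the
  coordinates \<open>0\<close> and \<open>n + 1\<close> of \<open>p\<close> force the values \<open>x\<close> and \<open>y\<close> of the cosine and the sine.\<close>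

lemma sphere_susp_surj:
  assumes p: "p \<in> topspace (nsphere (Suc n))" and ne: "p \<noteq> sphere_base"
  obtains s t where "s \<in> topspace (nsphere n)" "t \<in> {0..1}" "p = sphere_susp n s t"
proof -
  define q where "q = 1 - p 0"
  define P where "P = p (Suc n)"
  define S where "S = (\<Sum>i\<in>{1..n}. (p i / q)\<^sup>2)"
  have q: "q > 0"
    using nsphere_coord0[OF p] nsphere_eq_base_iff[OF p] ne by (auto simp: q_def)
  have "(p 0)\<^sup>2 + ((\<Sum>i\<in>{1..n}. (p i)\<^sup>2) + P\<^sup>2) = 1"
    using p by (simp add: in_nsphere_iff P_def)
  moreover have "p 0 = 1 - q" by (simp add: q_def)
  ultimately have sum: "(\<Sum>i\<in>{1..n}. (p i)\<^sup>2) = 2 * q - q\<^sup>2 - P\<^sup>2"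
    by (simp add: power2_eq_square algebra_simps)
  have "S = (\<Sum>i\<in>{1..n}. (p i)\<^sup>2) / q\<^sup>2" by (simp add: S_def power_divide sum_divide_distrib)
  then have S: "S + 1 = (2 * q - P\<^sup>2) / q\<^sup>2"
    using q by (simp add: sum[simplified] field_simps)
  have S0: "S \<ge> 0" by (simp add: S_def sum_nonneg)
  define s where "s = (\<lambda>i. if i = 0 then (S - 1) / (S + 1) else if i \<le> n then 2 * (p i / q) / (S + 1) else 0)"
  have "(\<Sum>i\<in>{1..n}. (s i)\<^sup>2) = (\<Sum>i\<in>{1..n}. (2 / (S + 1))\<^sup>2 * (p i / q)\<^sup>2)"
    by (rule sum.cong) (auto simp: s_def power_mult_distrib power_divide)
  also have "\<dots> = (2 / (S + 1))\<^sup>2 * S" by (simp add: S_def sum_distrib_left)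
  finally have "(\<Sum>i\<in>{1..n}. (s i)\<^sup>2) = 4 * S / (S + 1)\<^sup>2" by (simp add: power_divide)
  moreover have "(s 0)\<^sup>2 + 4 * S / (S + 1)\<^sup>2 = 1"
  proof -
    have "(S - 1)\<^sup>2 + 4 * S = (S + 1)\<^sup>2" by (simp add: power2_eq_square algebra_simps)
    then show ?thesis using S0 by (simp add: s_def power_divide flip: add_divide_distrib)
  qed
  ultimately have s: "s \<in> topspace (nsphere n)" by (auto simp: in_nsphere_iff s_def)
  have r: "(1 - s 0) / 2 = 1 / (S + 1)" using S0 by (simp add: s_def field_simps)
  define x where "x = 1 - q * (S + 1)"
  define y where "y = P * sqrt (S + 1)"
  have x: "x = P\<^sup>2 / q - 1" unfolding x_def S using q by (simp add: field_simps power2_eq_square)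
  have "y\<^sup>2 = P\<^sup>2 * (S + 1)" using S0 by (simp add: y_def power_mult_distrib)
  then have y: "y\<^sup>2 = P\<^sup>2 * (2 * q - P\<^sup>2) / q\<^sup>2" by (simp add: S)
  have "x\<^sup>2 + y\<^sup>2 = 1" unfolding x y using q by (simp add: field_simps power2_eq_square)
  then obtain \<tau> where \<tau>: "0 \<le> \<tau>" "\<tau> < 2 * pi" "x = cos \<tau>" "y = sin \<tau>"
    using sincos_total_2pi[of x y] by metis
  define t where "t = \<tau> / (2 * pi)"
  have t: "t \<in> {0..1}" "2 * pi * t = \<tau>" using \<tau> by (auto simp: t_def)
  have "p = sphere_susp n s t"
  proof
    fix i
    consider "i = 0" | "i \<in> {1..n}" | "i = Suc n" | "i > Suc n"
      by (cases "i = 0"; cases "i \<le> n"; cases "i = Suc n") auto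
    then show "p i = sphere_susp n s t i"
    proof cases
      case 1
      have "(1 - x) * (1 / (S + 1)) = q" using S0 by (simp add: x_def)
      then show ?thesis using 1 unfolding sphere_susp_simps r t \<tau>(3)[symmetric] 
        by (simp add: sphere_susp_simps r t \<tau>(3)[symmetric] q_def)
    next
      case 2
      have "(1 - x) / 2 * s i = p i" using 2 S0 q by (simp add: x_def s_def)
      then show ?thesis using 2 by (simp add: sphere_susp_simps t \<tau>(3)[symmetric])
    next
      case 3
      have "y * sqrt (1 / (S + 1)) = P" using S0 by (simp add: y_def real_sqrt_divide)
      then show ?thesis using 3 by (simp add: sphere_susp_simps r t \<tau>(4)[symmetric] P_def)
    next
      case 4
      then show ?thesis using p by (auto simp: sphere_susp_def sphere_base_def s_def in_nsphere_iff)
    qed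
  qed
  then show thesis using that s t by blast
qed

lemma sphere_susp_image:
  "(\<lambda>(t, s). sphere_susp n s t) ` topspace (prod_topology interval (nsphere n))
    = topspace (nsphere (Suc n))" (is "?f ` ?A = ?B")
proof
  show "?f ` ?A \<subseteq> ?B" using sphere_susp_in_nsphere by auto
  show "?B \<subseteq> ?f ` ?A"
  proof
    fix p assume p: "p \<in> ?B"
    show "p \<in> ?f ` ?A"
    proof (cases "p = sphere_base")
      case True
      then have "p = ?f (0, sphere_base)" by simp
      then show ?thesis by (rule image_eqI) simp
    next
      case False
      then obtain s t where st: "s \<in> topspace (nsphere n)" "t \<in> {0..1}" "p = sphere_susp n s t"
        using sphere_susp_surj[OF p] by metis
      then have "p = ?f (t, s)" by simp
      then show ?thesis by (rule image_eqI) (use st in simp)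
    qed
  qed
qed

lemma Hausdorff_space_nsphere [simp]: "Hausdorff_space (nsphere n)"
  unfolding nsphere
  by (intro Hausdorff_space_subtopology) (simp add: Hausdorff_space_product_topology)

lemma nsphere_0_cases:
  assumes "s \<in> topspace (nsphere 0)"
  shows "s = sphere_base \<or> s = (\<lambda>i. - sphere_base i)"
proof -
  have "s 0 = 1 \<or> s 0 = - 1" using assms by (simp add: in_nsphere_iff power2_eq_1_iff)
  then show ?thesis using assms by (auto simp: in_nsphere_iff sphere_base_def fun_eq_iff)
qed

lemma compact_space_nsphere [simp]: "compact_space (nsphere n)"
proof (induction n)
  case 0
  have "topspace (nsphere 0) \<subseteq> {sphere_base, \<lambda>i. - sphere_base i}" using nsphere_0_cases by auto
  then have "finite (topspace (nsphere 0))" using finite_subset by blast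
  then show ?case by (simp add: finite_topspace_imp_discrete_topology finite_imp_compactin compact_space_def)
next
  case (Suc n)
  then have "compact_space (prod_topology interval (nsphere n))"
    by (simp add: compact_space_prod_topology compact_space_subtopology)
  then have "compactin (nsphere (Suc n)) ((\<lambda>(t, s). sphere_susp n s t) ` topspace (prod_topology interval (nsphere n)))"
    using continuous_map_sphere_susp image_compactin compact_space_def by blast
  then show ?case by (simp only: sphere_susp_image compact_space_def)
qed

lemma compact_interval [simp]: "compact_space interval"
  by (simp add: compact_space_subtopology)

lemma Hausdorff_interval [simp]: "Hausdorff_space interval"
  by (simp add: Hausdorff_space_subtopology)


section \<open>Pointed homotopies\<close>

lemma continuous_map_compose_pair:
  assumes "continuous_map (prod_topology A B) C h" "continuous_map W A a" "continuous_map W B b"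
  shows "continuous_map W C (\<lambda>w. h (a w, b w))"
  using continuous_map_compose[OF continuous_map_pairedI[OF assms(2,3)] assms(1)] by (simp add: o_def)

lemma continuous_map_interval_real:
  "continuous_map W interval g \<longleftrightarrow> continuous_map W euclideanreal g \<and> (\<forall>w\<in>topspace W. g w \<in> {0..1})"
  by (auto simp: continuous_map_in_subtopology)

lemma pointed_homotopicI:
  assumes "continuous_map (prod_topology interval W) Y h" and "w0 \<in> topspace W"
    and "\<And>w. w \<in> topspace W \<Longrightarrow> h (0, w) = f w" "\<And>w. w \<in> topspace W \<Longrightarrow> h (1, w) = g w"
    and "\<And>t. t \<in> {0..1} \<Longrightarrow> h (t, w0) = y0"
  shows "pointed_homotopic W w0 Y y0 f g"
  unfolding pointed_homotopic_def
proof (rule iffD2[OF homotopic_with])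
  show "\<exists>h. continuous_map (prod_topology interval W) Y h \<and> (\<forall>x\<in>topspace W. h (0, x) = f x) \<and>
      (\<forall>x\<in>topspace W. h (1, x) = g x) \<and> (\<forall>t\<in>{0..1}. h (t, w0) = y0)"
    using assms by blast
qed (simp add: assms(2))

lemma pointed_homotopicE:
  assumes "pointed_homotopic W w0 Y y0 f g"
  obtains h where "continuous_map (prod_topology interval W) Y h"
    "\<And>w. h (0, w) = f w" "\<And>w. h (1, w) = g w" "\<And>t. t \<in> {0..1} \<Longrightarrow> h (t, w0) = y0"
  using assms[unfolded pointed_homotopic_def homotopic_with_def] that by (elim exE conjE) simp

lemma pointed_homotopic_imp_pointed_map:
  assumes "pointed_homotopic W w0 Y y0 f g"
  shows "pointed_map W w0 Y y0 f" "pointed_map W w0 Y y0 g"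
  using homotopic_with_imp_continuous_maps[OF assms[unfolded pointed_homotopic_def]]
    homotopic_with_imp_property[OF assms[unfolded pointed_homotopic_def]]
  by (simp_all add: pointed_map_def)

lemma pointed_homotopic_refl [simp]:
  "pointed_homotopic W w0 Y y0 f f \<longleftrightarrow> pointed_map W w0 Y y0 f"
  by (simp add: pointed_homotopic_def pointed_map_def)

lemma pointed_homotopic_sym:
  "pointed_homotopic W w0 Y y0 f g \<Longrightarrow> pointed_homotopic W w0 Y y0 g f"
  unfolding pointed_homotopic_def by (rule homotopic_with_symD)

lemma pointed_homotopic_trans [trans]:
  "pointed_homotopic W w0 Y y0 f g \<Longrightarrow> pointed_homotopic W w0 Y y0 g h
    \<Longrightarrow> pointed_homotopic W w0 Y y0 f h"
  unfolding pointed_homotopic_def by (rule homotopic_with_trans)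

lemma pointed_homotopic_eq:
  assumes "pointed_map W w0 Y y0 f" "w0 \<in> topspace W" "\<And>w. w \<in> topspace W \<Longrightarrow> f w = g w"
  shows "pointed_homotopic W w0 Y y0 f g"
  unfolding pointed_homotopic_def
  by (rule homotopic_with_equal) (use assms in \<open>simp_all add: pointed_map_def\<close>)

lemma pointed_homotopic_postcompose:
  assumes "pointed_homotopic W w0 X x0 f g" "pointed_map X x0 Y y0 p"
  shows "pointed_homotopic W w0 Y y0 (p \<circ> f) (p \<circ> g)"
  unfolding pointed_homotopic_def
  by (rule homotopic_with_compose_continuous_map_left[OF assms(1)[unfolded pointed_homotopic_def]])
    (use assms(2) in \<open>auto simp: pointed_map_def\<close>)

lemma pointed_homotopic_precompose:
  assumes "pointed_homotopic X x0 Y y0 f g" "pointed_map W w0 X x0 p"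
  shows "pointed_homotopic W w0 Y y0 (f \<circ> p) (g \<circ> p)"
  unfolding pointed_homotopic_def
  by (rule homotopic_with_compose_continuous_map_right[OF assms(1)[unfolded pointed_homotopic_def]])
    (use assms(2) in \<open>auto simp: pointed_map_def\<close>)

lemma pointed_map_compose:
  "pointed_map W w0 X x0 f \<Longrightarrow> pointed_map X x0 Y y0 g \<Longrightarrow> pointed_map W w0 Y y0 (g \<circ> f)"
  by (auto simp: pointed_map_def intro: continuous_map_compose)


section \<open>Path spaces\<close>

definition adjoint_path :: "(real \<times> 'w \<Rightarrow> 'y) \<Rightarrow> 'w \<Rightarrow> real \<Rightarrow> 'y"
  where "adjoint_path h w = (\<lambda>t\<in>{0..1}. h (t, w))"

lemma adjoint_path_apply [simp]: "t \<in> {0..1} \<Longrightarrow> adjoint_path h w t = h (t, w)"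
  by (simp add: adjoint_path_def)

lemma adjoint_path_cong:
  assumes "\<And>t. t \<in> {0..1} \<Longrightarrow> h (t, w) = h' (t, w')"
  shows "adjoint_path h w = adjoint_path h' w'"
  using assms by (auto simp: adjoint_path_def fun_eq_iff)

lemma adjoint_path_eq_const:
  assumes "\<And>t. t \<in> {0..1} \<Longrightarrow> h (t, w) = y0"
  shows "adjoint_path h w = const_path y0"
  using assms by (auto simp: adjoint_path_def const_path_def fun_eq_iff)

lemma topspace_path_space [simp]: "topspace (path_space Y) = paths Y"
proof -
  have "{\<gamma> \<in> paths Y. \<gamma> ` {} \<subseteq> topspace Y} = paths Y" by simp
  then have "paths Y \<in> {{\<gamma> \<in> paths Y. \<gamma> ` K \<subseteq> U} | K U. compact K \<and> K \<subseteq> {0..1} \<and> openin Y U}"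
    by (intro CollectI exI[of _ "{}"] exI[of _ "topspace Y"]) simp
  then show ?thesis
    unfolding path_space_def topology_generated_by_topspace by (intro equalityI Union_least Union_upper) auto
qed

text \<open>The paths that map a compact set \<open>K\<close> into an open set \<open>U\<close> have an open preimage by the tube lemma, which
  enters as the closedness of the projection along \<open>K\<close>.\<close>

lemma continuous_map_adjoint_path:
  assumes h: "continuous_map (prod_topology interval W) Y h"
  shows "continuous_map W (path_space Y) (adjoint_path h)"
  unfolding path_space_def
proof (rule continuous_on_generated_topo)
  have paths: "adjoint_path h w \<in> paths Y" if "w \<in> topspace W" for w
  proof -
    have "continuous_map interval Y (\<lambda>t. h (t, w))"
      by (rule continuous_map_compose_pair[OF h]) (use that in auto)
    then have "continuous_map interval Y (adjoint_path h w)"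
      by (rule continuous_map_eq) simp
    then show ?thesis by (simp add: paths_def pathin_def adjoint_path_def)
  qed
  let ?S = "{{\<gamma> \<in> paths Y. \<gamma> ` K \<subseteq> U} | K U. compact K \<and> K \<subseteq> {0..1::real} \<and> openin Y U}"
  show "adjoint_path h ` topspace W \<subseteq> \<Union> ?S"
    using paths topspace_path_space[of Y] unfolding path_space_def topology_generated_by_topspace
    by blast
  fix V assume "V \<in> ?S"
  then obtain K U where V: "V = {\<gamma> \<in> paths Y. \<gamma> ` K \<subseteq> U}"
    and K: "compact K" "K \<subseteq> {0..1::real}" and U: "openin Y U" by blast
  let ?KW = "prod_topology (top_of_set K) W"
  have "continuous_map ?KW interval fst"
    using continuous_map_fst[of "top_of_set K" W] K(2) by (auto simp: continuous_map_in_subtopology)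
  then have "continuous_map ?KW Y (\<lambda>p. h (fst p, snd p))"
    by (rule continuous_map_compose_pair[OF h]) (rule continuous_map_snd)
  then have hK: "continuous_map ?KW Y h" by simp
  have "closedin ?KW {p \<in> topspace ?KW. h p \<in> topspace Y - U}"
    by (rule closedin_continuous_map_preimage[OF hK]) (use U in blast)
  moreover have "closed_map ?KW W snd"
    by (rule closed_map_snd) (simp add: K(1) compact_space_subtopology)
  ultimately have "closedin W (snd ` {p \<in> topspace ?KW. h p \<in> topspace Y - U})" (is "closedin W ?C")
    by (simp add: closed_map_def)
  then have "openin W (topspace W - ?C)" by blast
  moreover have "adjoint_path h -` V \<inter> topspace W = topspace W - ?C"
  proof -
    have "adjoint_path h w \<in> V \<longleftrightarrow> w \<notin> ?C" if w: "w \<in> topspace W" for w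
    proof -
      have "h (t, w) \<in> topspace Y" if "t \<in> K" for t
        using continuous_map_image_subset_topspace[OF hK] that w by auto
      then have "w \<in> ?C \<longleftrightarrow> (\<exists>t\<in>K. h (t, w) \<notin> U)" using w by (auto simp: image_iff)
      moreover have "adjoint_path h w \<in> V \<longleftrightarrow> (\<forall>t\<in>K. h (t, w) \<in> U)"
        using paths[OF w] K(2) by (auto simp: V image_subset_iff subset_iff)
      ultimately show ?thesis by blast
    qed
    then show ?thesis by blast
  qed
  ultimately show "openin W (adjoint_path h -` V \<inter> topspace W)" by (simp only:)
qed

text \<open>This holds because the interval is locally compact: near \<open>(t0, \<gamma>0)\<close> take the paths that map a small
  closed interval around \<open>t0\<close> into \<open>U\<close>.\<close>

lemma continuous_map_path_eval:
  "continuous_map (prod_topology interval (path_space Y)) Y (\<lambda>(t, \<gamma>). \<gamma> t)"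
  unfolding continuous_map_def
proof (intro conjI allI impI)
  show "(\<lambda>(t, \<gamma>). \<gamma> t) \<in> topspace (prod_topology interval (path_space Y)) \<rightarrow> topspace Y"
    by (auto simp: paths_def pathin_def continuous_map_def Pi_iff)
  fix U assume U: "openin Y U"
  let ?S = "{p \<in> topspace (prod_topology interval (path_space Y)). (case p of (t, \<gamma>) \<Rightarrow> \<gamma> t) \<in> U}"
  show "openin (prod_topology interval (path_space Y)) ?S"
    unfolding openin_prod_topology_alt
  proof (intro allI impI)
    fix t0 :: real and \<gamma>0 assume "(t0, \<gamma>0) \<in> ?S"
    then have t0: "t0 \<in> {0..1}" and \<gamma>0: "\<gamma>0 \<in> paths Y" and in_U: "\<gamma>0 t0 \<in> U" by auto
    have "continuous_map interval Y \<gamma>0" using \<gamma>0 by (simp add: paths_def pathin_def)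
    then have "openin interval {t \<in> topspace interval. \<gamma>0 t \<in> U}"
      using U by (rule openin_continuous_map_preimage)
    then obtain e where e: "e > 0" "cball t0 e \<inter> {0..1} \<subseteq> {t \<in> topspace interval. \<gamma>0 t \<in> U}"
      unfolding openin_contains_cball using t0 in_U by auto
    define K where "K = cball t0 e \<inter> {0..1}"
    have K: "compact K" "K \<subseteq> {0..1}" by (auto simp: K_def compact_Int)
    have "{\<gamma> \<in> paths Y. \<gamma> ` K \<subseteq> U} \<in> {{\<gamma> \<in> paths Y. \<gamma> ` K \<subseteq> U} | K U. compact K \<and> K \<subseteq> {0..1::real} \<and> openin Y U}"
      using K U by blast
    then have "openin (path_space Y) {\<gamma> \<in> paths Y. \<gamma> ` K \<subseteq> U}"
      unfolding path_space_def by (rule topology_generated_by_Basis)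
    moreover have "openin interval ({0..1} \<inter> ball t0 e)" by blast
    moreover have "({0..1} \<inter> ball t0 e) \<times> {\<gamma> \<in> paths Y. \<gamma> ` K \<subseteq> U} \<subseteq> ?S"
      by (auto simp: K_def)
    moreover have "\<gamma>0 ` K \<subseteq> U" using e by (auto simp: K_def)
    ultimately show "\<exists>A B. openin interval A \<and> openin (path_space Y) B \<and> t0 \<in> A \<and> \<gamma>0 \<in> B \<and> A \<times> B \<subseteq> ?S"
      using t0 \<gamma>0 e(1) by (intro exI[of _ "{0..1} \<inter> ball t0 e"] exI[of _ "{\<gamma> \<in> paths Y. \<gamma> ` K \<subseteq> U}"]) auto
  qed
qed


section \<open>Lifting homotopies\<close>

text \<open>The definition of a fibration speaks about spaces of one type only. The space of pairs \<open>(x, \<gamma>)\<close> with \<open>\<gamma>\<close>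
  a path from \<open>f x\<close> has this type and carries a universal lifting problem: evaluate \<open>\<gamma>\<close>. Any other
  problem is its pullback along \<open>w \<mapsto> (g w, h(-, w))\<close>.\<close>

lemma hurewicz_fibration_lift:
  fixes X :: "'x topology" and Y :: "'y topology" and W :: "'w topology"
  assumes fib: "hurewicz_fibration X Y f" and g: "continuous_map W X g"
    and h: "continuous_map (prod_topology interval W) Y h"
    and start: "\<And>w. w \<in> topspace W \<Longrightarrow> h (0, w) = f (g w)"
  obtains H where "continuous_map (prod_topology interval W) X H"
    "\<And>w. w \<in> topspace W \<Longrightarrow> H (0, w) = g w"
    "\<And>t w. t \<in> {0..1} \<Longrightarrow> w \<in> topspace W \<Longrightarrow> f (H (t, w)) = h (t, w)"
proof -
  define P where "P = subtopology (prod_topology X (path_space Y)) {(x, \<gamma>). \<gamma> 0 = f x}"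
  have fst: "continuous_map P X fst" and snd: "continuous_map P (path_space Y) snd"
    unfolding P_def by (auto intro!: continuous_map_from_subtopology continuous_map_fst continuous_map_snd)
  have "continuous_map (prod_topology interval P) Y (\<lambda>p. case (fst p, snd (snd p)) of (t, \<gamma>) \<Rightarrow> \<gamma> t)"
    by (intro continuous_map_compose_pair[OF continuous_map_path_eval] continuous_map_fst
        continuous_map_compose[OF continuous_map_snd snd, unfolded o_def])
  then have ev: "continuous_map (prod_topology interval P) Y (\<lambda>(t, p). snd p t)"
    by (simp add: case_prod_unfold)
  have lift: "\<exists>H. continuous_map (prod_topology interval V) X H \<and> (\<forall>v\<in>topspace V. H (0, v) = k v) \<and>
      (\<forall>t\<in>{0..1}. \<forall>v\<in>topspace V. f (H (t, v)) = e (t, v))"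
    if "continuous_map V X k" "continuous_map (prod_topology interval V) Y e"
      "\<forall>v\<in>topspace V. e (0, v) = f (k v)" for V :: "('x \<times> (real \<Rightarrow> 'y)) topology" and k e
    using fib that unfolding hurewicz_fibration_def by blast
  have "\<exists>H. continuous_map (prod_topology interval P) X H \<and> (\<forall>p\<in>topspace P. H (0, p) = fst p) \<and>
      (\<forall>t\<in>{0..1}. \<forall>p\<in>topspace P. f (H (t, p)) = (\<lambda>(t, p). snd p t) (t, p))"
    by (rule lift[OF fst ev]) (auto simp: P_def)
  then obtain H where H: "continuous_map (prod_topology interval P) X H"
    "\<And>p. p \<in> topspace P \<Longrightarrow> H (0, p) = fst p"
    "\<And>t p. t \<in> {0..1} \<Longrightarrow> p \<in> topspace P \<Longrightarrow> f (H (t, p)) = snd p t" by auto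
  define k where "k = (\<lambda>w. (g w, adjoint_path h w))"
  have k: "continuous_map W P k"
    unfolding P_def continuous_map_in_subtopology
    by (auto simp: k_def start intro!: continuous_map_pairedI g continuous_map_adjoint_path h)
  then have kP: "k w \<in> topspace P" if "w \<in> topspace W" for w
    using that continuous_map_image_subset_topspace by blast
  show thesis
  proof
    show "continuous_map (prod_topology interval W) X (\<lambda>p. H (fst p, k (snd p)))"
      by (intro continuous_map_compose_pair[OF H(1)] continuous_map_fst
          continuous_map_compose[OF continuous_map_snd k, unfolded o_def])
  qed (use H(2,3) kP in \<open>auto simp: k_def\<close>)
qed

text \<open>A relative form of the lifting property. Lift the homotopy that runs through \<open>h (-, w)\<close> faster, within
  the time \<open>\<phi> w\<close>, and then slow down the lift by the factor \<open>\<phi> w\<close>. Where \<open>\<phi>\<close> vanishes, the slowed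
  lift never leaves its starting point.\<close>

lemma hurewicz_fibration_lift_stationary:
  fixes X :: "'x topology" and Y :: "'y topology" and W :: "'w topology"
  assumes fib: "hurewicz_fibration X Y f" and g: "continuous_map W X g"
    and h: "continuous_map (prod_topology interval W) Y h"
    and start: "\<And>w. w \<in> topspace W \<Longrightarrow> h (0, w) = f (g w)"
    and \<phi>: "continuous_map W interval \<phi>"
    and stat: "\<And>t w. t \<in> {0..1} \<Longrightarrow> w \<in> topspace W \<Longrightarrow> \<phi> w = 0 \<Longrightarrow> h (t, w) = h (0, w)"
  obtains H where "continuous_map (prod_topology interval W) X H"
    "\<And>w. w \<in> topspace W \<Longrightarrow> H (0, w) = g w"
    "\<And>t w. t \<in> {0..1} \<Longrightarrow> w \<in> topspace W \<Longrightarrow> f (H (t, w)) = h (t, w)"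
    "\<And>t w. t \<in> {0..1} \<Longrightarrow> w \<in> topspace W \<Longrightarrow> \<phi> w = 0 \<Longrightarrow> H (t, w) = g w"
proof -
  let ?IW = "prod_topology interval W"
  have \<phi>01: "0 \<le> \<phi> w" "\<phi> w \<le> 1" if "w \<in> topspace W" for w
    using \<phi> that by (auto simp: continuous_map_interval_real)
  have \<phi>r: "continuous_map ?IW euclideanreal (\<lambda>p. \<phi> (snd p))"
    using continuous_map_compose[OF continuous_map_snd \<phi>]
    by (auto simp: continuous_map_interval_real o_def)
  have tr: "continuous_map ?IW euclideanreal fst"
    using continuous_map_fst[of interval W] by (simp add: continuous_map_interval_real)
  define k where "k = (\<lambda>(t, w). h (if \<phi> w = 0 then 0 else min 1 (t / \<phi> w), w))"
  have k: "continuous_map ?IW Y k"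
    unfolding continuous_map_def
  proof (intro conjI allI impI)
    have hY: "h (t, w) \<in> topspace Y" if "t \<in> {0..1}" "w \<in> topspace W" for t w
      using continuous_map_image_subset_topspace[OF h] that by auto
    show "k \<in> topspace ?IW \<rightarrow> topspace Y"
      using \<phi>01 by (auto simp: k_def intro!: hY)
    fix U assume U: "openin Y U"
    let ?P = "subtopology ?IW {p \<in> topspace ?IW. \<phi> (snd p) > 0}"
    have P: "openin ?IW {p \<in> topspace ?IW. \<phi> (snd p) > 0}"
      using openin_continuous_map_preimage[OF \<phi>r, of "{0<..}"] by simp
    have frac: "continuous_map ?P interval (\<lambda>p. min 1 (fst p / \<phi> (snd p)))"
      unfolding continuous_map_interval_real
    proof
      show "continuous_map ?P euclideanreal (\<lambda>p. min 1 (fst p / \<phi> (snd p)))"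
        by (intro continuous_intros continuous_map_from_subtopology[OF tr]
            continuous_map_from_subtopology[OF \<phi>r]) auto
    qed auto
    have "continuous_map ?P Y (\<lambda>p. h (min 1 (fst p / \<phi> (snd p)), snd p))"
      by (intro continuous_map_compose_pair[OF h] frac continuous_map_from_subtopology continuous_map_snd)
    then have "openin ?P {p \<in> topspace ?P. h (min 1 (fst p / \<phi> (snd p)), snd p) \<in> U}"
      using U by (rule openin_continuous_map_preimage)
    then have A: "openin ?IW {p \<in> topspace ?P. h (min 1 (fst p / \<phi> (snd p)), snd p) \<in> U}"
      using P by (rule openin_trans_full)
    \<comment> \<open>The accelerated homotopy is continuous where \<open>\<phi>\<close> vanishes by the tube lemma: if the single
      value of \<open>h (-, w)\<close> lies in \<open>U\<close>, so do all values of \<open>h (-, w')\<close> for \<open>w'\<close> near \<open>w\<close>.\<close>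
    have "closedin W (snd ` {p \<in> topspace ?IW. h p \<in> topspace Y - U})"
      using closed_map_snd[OF compact_interval, of W]
        closedin_continuous_map_preimage[OF h, of "topspace Y - U"] U
      by (auto simp: closed_map_def)
    then have "openin W (topspace W - snd ` {p \<in> topspace ?IW. h p \<in> topspace Y - U})"
      by blast
    then have B: "openin ?IW ({0..1} \<times> (topspace W - snd ` {p \<in> topspace ?IW. h p \<in> topspace Y - U}))"
      unfolding openin_prod_Times_iff by (metis openin_topspace topspace_euclidean_subtopology)
    have "{p \<in> topspace ?IW. k p \<in> U} =
        {p \<in> topspace ?P. h (min 1 (fst p / \<phi> (snd p)), snd p) \<in> U} \<union>
        ({0..1} \<times> (topspace W - snd ` {p \<in> topspace ?IW. h p \<in> topspace Y - U}))" (is "?L = ?A \<union> ?B")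
    proof (intro equalityI subsetI)
      fix p assume "p \<in> ?L"
      then obtain t w where p: "p = (t, w)" "t \<in> {0..1}" "w \<in> topspace W" "k (t, w) \<in> U" by auto
      show "p \<in> ?A \<union> ?B"
      proof (cases "\<phi> w = 0")
        case True
        then have "h (u, w) \<in> U" if "u \<in> {0..1}" for u
          using p(4) stat[OF that p(3)] by (simp add: k_def)
        then have "p \<in> ?B" using p by auto
        then show ?thesis ..
      next
        case False
        then show ?thesis using p \<phi>01[OF p(3)] by (auto simp: k_def)
      qed
    next
      fix p assume p: "p \<in> ?A \<union> ?B"
      show "p \<in> ?L"
      proof (cases "p \<in> ?A")
        case True
        then show ?thesis by (auto simp: k_def)
      next
        case False
        then obtain t w where tw: "p = (t, w)" "t \<in> {0..1}" "w \<in> topspace W"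
          "w \<notin> snd ` {p \<in> topspace ?IW. h p \<in> topspace Y - U}" using p by auto
        have "h (u, w) \<in> U" if "u \<in> {0..1}" for u
        proof (rule ccontr)
          assume "h (u, w) \<notin> U"
          then have "(u, w) \<in> {p \<in> topspace ?IW. h p \<in> topspace Y - U}" using that tw(3) hY by auto
          then show False using tw(4) by force
        qed
        then show ?thesis using tw \<phi>01[OF tw(3)] by (auto simp: k_def)
      qed
    qed
    then show "openin ?IW {p \<in> topspace ?IW. k p \<in> U}" using A B by (simp only: openin_Un)
  qed
  have k0: "k (0, w) = f (g w)" if "w \<in> topspace W" for w
    using start[OF that] by (simp add: k_def)
  obtain G where G: "continuous_map ?IW X G" "\<And>w. w \<in> topspace W \<Longrightarrow> G (0, w) = g w"
    "\<And>t w. t \<in> {0..1} \<Longrightarrow> w \<in> topspace W \<Longrightarrow> f (G (t, w)) = k (t, w)"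
    using hurewicz_fibration_lift[OF fib g k k0] by metis
  show thesis
  proof
    show "continuous_map ?IW X (\<lambda>p. G (fst p * \<phi> (snd p), snd p))"
    proof (intro continuous_map_compose_pair[OF G(1)] continuous_map_snd)
      show "continuous_map ?IW interval (\<lambda>p. fst p * \<phi> (snd p))"
        unfolding continuous_map_interval_real
        using \<phi>01 by (auto intro!: continuous_intros tr \<phi>r mult_le_one)
    qed
    fix t :: real and w assume t: "t \<in> {0..1}" and w: "w \<in> topspace W"
    have "t * \<phi> w \<in> {0..1}" using t \<phi>01[OF w] by (auto intro: mult_le_one)
    then show "f (G (fst (t, w) * \<phi> (snd (t, w)), snd (t, w))) = h (t, w)"
      using G(3) w t stat[OF t w] by (auto simp: k_def)
  qed (use G(2) in auto)
qed


section \<open>Maps out of a suspension\<close>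

lemma sphere_susp_eq_base_iff:
  assumes s: "s \<in> topspace (nsphere n)" and t: "t \<in> {0..1}"
  shows "sphere_susp n s t = sphere_base \<longleftrightarrow> s = sphere_base \<or> t = 0 \<or> t = 1"
proof
  assume "sphere_susp n s t = sphere_base"
  then have "sphere_susp n s t 0 = 1" by (simp add: sphere_base_def)
  then have "s 0 = 1 \<or> cos (2 * pi * t) = 1" by (auto simp: sphere_susp_simps)
  moreover have "t = 0 \<or> t = 1" if "cos (2 * pi * t) = 1"
  proof -
    obtain k :: int where "2 * pi * t = k * 2 * pi" using \<open>cos (2 * pi * t) = 1\<close> by (auto simp: cos_one_2pi_int)
    then have "t = k" by simp
    then have "k = 0 \<or> k = 1" using t by auto
    then show ?thesis using \<open>t = k\<close> by auto
  qed
  ultimately show "s = sphere_base \<or> t = 0 \<or> t = 1"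
    using nsphere_eq_base_iff[OF s] by blast
qed auto

text \<open>A continuous surjection from a compact to a Hausdorff space is a quotient map, and this one identifies
  points only over the base point. The parameter \<open>u\<close> stands inside the quotient so that the lemma
  serves for maps and for homotopies of maps out of the suspension.\<close>

lemma homotopy_descends_to_suspension:
  assumes G: "continuous_map (prod_topology interval (prod_topology interval (nsphere m))) Y G"
    and G0: "\<And>u s. u \<in> {0..1} \<Longrightarrow> s \<in> topspace (nsphere m) \<Longrightarrow> G (u, 0, s) = y0"
    and G1: "\<And>u s. u \<in> {0..1} \<Longrightarrow> s \<in> topspace (nsphere m) \<Longrightarrow> G (u, 1, s) = y0"
    and Gb: "\<And>u t. u \<in> {0..1} \<Longrightarrow> t \<in> {0..1} \<Longrightarrow> G (u, t, sphere_base) = y0"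
  obtains h where "continuous_map (prod_topology interval (nsphere (Suc m))) Y h"
    "\<And>u t s. u \<in> {0..1} \<Longrightarrow> t \<in> {0..1} \<Longrightarrow> s \<in> topspace (nsphere m) \<Longrightarrow>
       h (u, sphere_susp m s t) = G (u, t, s)"
    "\<And>u. u \<in> {0..1} \<Longrightarrow> h (u, sphere_base) = y0"
proof -
  let ?A = "prod_topology interval (prod_topology interval (nsphere m))"
  let ?B = "prod_topology interval (nsphere (Suc m))"
  let ?q = "\<lambda>p. (fst p, (\<lambda>(t, s). sphere_susp m s t) (snd p))"
  have q: "quotient_map ?A ?B ?q"
  proof (rule continuous_imp_quotient_map)
    show "continuous_map ?A ?B ?q"
      by (intro continuous_map_pairedI continuous_map_fst
          continuous_map_compose[OF continuous_map_snd continuous_map_sphere_susp, unfolded o_def])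
    show "?q ` topspace ?A = topspace ?B"
      unfolding topspace_prod_topology[of interval] sphere_susp_image[symmetric] by force
  qed (simp_all add: compact_space_prod_topology Hausdorff_space_prod_topology)
  have G_eq: "G p = G p'" if p: "p \<in> topspace ?A" "p' \<in> topspace ?A" and eq: "?q p = ?q p'" for p p'
  proof -
    obtain u t s u' t' s' where pp: "p = (u, t, s)" "p' = (u', t', s')" by (metis prod_cases3)
    have in_A: "u \<in> {0..1}" "t \<in> {0..1}" "s \<in> topspace (nsphere m)"
      "u' \<in> {0..1}" "t' \<in> {0..1}" "s' \<in> topspace (nsphere m)" using p pp by auto
    have eq': "u = u'" "sphere_susp m s t = sphere_susp m s' t'" using eq pp by auto
    show ?thesis
    proof (cases "sphere_susp m s t = sphere_base")
      case True
      then show ?thesis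
        using eq' sphere_susp_eq_base_iff[of s m t] sphere_susp_eq_base_iff[of s' m t'] in_A G0 G1 Gb
        by (auto simp: pp)
    next
      case False
      then have "s = s' \<and> t = t'" using sphere_susp_inj[of s m s' t t'] in_A eq'(2) by blast
      then show ?thesis using eq' pp by simp
    qed
  qed
  obtain h where h: "continuous_map ?B Y h" "\<And>p. p \<in> topspace ?A \<Longrightarrow> h (?q p) = G p"
    by (rule quotient_map_lift_exists[OF q G]) (erule (2) G_eq, blast)
  show thesis
  proof
    show *: "h (u, sphere_susp m s t) = G (u, t, s)"
      if "u \<in> {0..1}" "t \<in> {0..1}" "s \<in> topspace (nsphere m)" for u t s
      using h(2)[of "(u, t, s)"] that by simp
    show "h (u, sphere_base) = y0" if "u \<in> {0..1}" for u
      using *[OF that, of 0 sphere_base] Gb[OF that, of 0] by simp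
  qed (rule h(1))
qed

lemma map_descends_to_suspension:
  assumes G: "continuous_map (prod_topology interval (nsphere m)) Y G"
    and "\<And>s. s \<in> topspace (nsphere m) \<Longrightarrow> G (0, s) = y0"
    and "\<And>s. s \<in> topspace (nsphere m) \<Longrightarrow> G (1, s) = y0"
    and "\<And>t. t \<in> {0..1} \<Longrightarrow> G (t, sphere_base) = y0"
  obtains a where "pointed_map (nsphere (Suc m)) sphere_base Y y0 a"
    "\<And>t s. t \<in> {0..1} \<Longrightarrow> s \<in> topspace (nsphere m) \<Longrightarrow> a (sphere_susp m s t) = G (t, s)"
proof -
  have "continuous_map (prod_topology interval (prod_topology interval (nsphere m))) Y (G \<circ> snd)"
    by (rule continuous_map_compose[OF continuous_map_snd G])
  then obtain h where h: "continuous_map (prod_topology interval (nsphere (Suc m))) Y h"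
    "\<And>u t s. u \<in> {0..1} \<Longrightarrow> t \<in> {0..1} \<Longrightarrow> s \<in> topspace (nsphere m) \<Longrightarrow>
       h (u, sphere_susp m s t) = (G \<circ> snd) (u, t, s)"
    "\<And>u. u \<in> {0..1} \<Longrightarrow> h (u, sphere_base) = y0"
    using assms(2-4) by (elim homotopy_descends_to_suspension[where ?y0.0 = y0]) auto
  show thesis
  proof
    have "continuous_map (nsphere (Suc m)) Y (\<lambda>s. h (0, s))"
      by (rule continuous_map_compose_pair[OF h(1)]) auto
    then show "pointed_map (nsphere (Suc m)) sphere_base Y y0 (\<lambda>s. h (0, s))"
      using h(3)[of 0] by (simp add: pointed_map_def)
    show "h (0, sphere_susp m s t) = G (t, s)" if "t \<in> {0..1}" "s \<in> topspace (nsphere m)" for t s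
      using h(2)[of 0 t s] that by simp
  qed
qed

lemma continuous_map_on_suspension:
  assumes "continuous_map (nsphere (Suc m)) Y a"
  shows "continuous_map (prod_topology interval (nsphere m)) Y (\<lambda>(t, s). a (sphere_susp m s t))"
  using continuous_map_compose[OF continuous_map_sphere_susp assms] by (simp add: o_def case_prod_unfold)

definition susp_adjoint :: "nat \<Rightarrow> ((nat \<Rightarrow> real) \<Rightarrow> 'y) \<Rightarrow> (nat \<Rightarrow> real) \<Rightarrow> real \<Rightarrow> 'y"
  where "susp_adjoint m a = adjoint_path (\<lambda>(t, s). a (sphere_susp m s t))"

lemma susp_adjoint_apply [simp]: "t \<in> {0..1} \<Longrightarrow> susp_adjoint m a s t = a (sphere_susp m s t)"
  by (simp add: susp_adjoint_def)

lemma pointed_map_susp_adjoint: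
  assumes "pointed_map (nsphere (Suc m)) sphere_base Y y0 a"
  shows "pointed_map (nsphere m) sphere_base (loop_space Y y0) (const_path y0) (susp_adjoint m a)"
proof -
  have "continuous_map (nsphere m) (path_space Y) (susp_adjoint m a)"
    unfolding susp_adjoint_def using assms
    by (intro continuous_map_adjoint_path continuous_map_on_suspension) (simp add: pointed_map_def)
  moreover have "susp_adjoint m a sphere_base = const_path y0"
    unfolding susp_adjoint_def by (rule adjoint_path_eq_const) (use assms in \<open>simp add: pointed_map_def\<close>)
  ultimately show ?thesis
    using assms by (auto simp: pointed_map_def loop_space_def continuous_map_in_subtopology)
qed

lemma continuous_map_sphere_height: "continuous_map (nsphere n) interval (\<lambda>s. (1 - s 0) / 2)"
  unfolding continuous_map_interval_real
proof
  show "continuous_map (nsphere n) euclideanreal (\<lambda>s. (1 - s 0) / 2)"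
    by (intro continuous_intros continuous_map_nsphere_projection) auto
  show "\<forall>s\<in>topspace (nsphere n). (1 - s 0) / 2 \<in> {0..1}"
    using nsphere_coord0 by force
qed


section \<open>The fibre and the homotopy fibre\<close>

locale fibre_sequence =
  fixes Z :: "'z topology" and z0 :: 'z and j :: "'z \<Rightarrow> 'x" and X :: "'x topology" and x0 :: 'x
    and f :: "'x \<Rightarrow> 'y" and Y :: "'y topology" and y0 :: 'y
  assumes fibration: "fibration_sequence Z z0 j X x0 f Y y0"
begin

abbreviation hofib :: "('x \<times> (real \<Rightarrow> 'y)) topology"
  where "hofib \<equiv> homotopy_fibre X f Y y0"

lemma base_points [simp]: "z0 \<in> topspace Z" "x0 \<in> topspace X" "y0 \<in> topspace Y" "j z0 = x0" "f x0 = y0"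
  using fibration by (simp_all add: fibration_sequence_def pointed_map_def)

lemma pointed_map_j: "pointed_map Z z0 X x0 j" and pointed_map_f: "pointed_map X x0 Y y0 f"
  and hurewicz_f: "hurewicz_fibration X Y f"
  using fibration by (simp_all add: fibration_sequence_def)

lemma continuous_j: "continuous_map Z X j" and continuous_f: "continuous_map X Y f"
  using pointed_map_j pointed_map_f by (simp_all add: pointed_map_def)

lemma f_j [simp]: "z \<in> topspace Z \<Longrightarrow> f (j z) = y0"
  using fibration by (auto simp: fibration_sequence_def)

lemma j_inject: "z \<in> topspace Z \<Longrightarrow> z' \<in> topspace Z \<Longrightarrow> j z = j z' \<Longrightarrow> z = z'"
  using fibration
  by (meson embedding_map_def fibration_sequence_def homeomorphic_imp_injective_map inj_on_def)

lemma map_into_fibre: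
  assumes u: "continuous_map T X u" and fu: "\<And>w. w \<in> topspace T \<Longrightarrow> f (u w) = y0"
  obtains v where "continuous_map T Z v" "\<And>w. w \<in> topspace T \<Longrightarrow> j (v w) = u w"
proof -
  let ?S = "subtopology X (j ` topspace Z)"
  have im: "j ` topspace Z = {x \<in> topspace X. f x = y0}" and "homeomorphic_map Z ?S j"
    using fibration by (auto simp: fibration_sequence_def embedding_map_def)
  then obtain g where g: "homeomorphic_maps Z ?S j g" by (auto simp: homeomorphic_map_maps)
  have uT: "u w \<in> topspace X" if "w \<in> topspace T" for w
    using continuous_map_image_subset_topspace[OF u] that by auto
  have "u w \<in> j ` topspace Z" if "w \<in> topspace T" for w
    unfolding im using uT fu that by simp
  then have uS: "continuous_map T ?S u" using u by (auto simp: continuous_map_in_subtopology)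
  show thesis
  proof
    show "continuous_map T Z (g \<circ> u)"
      using uS g by (auto simp: homeomorphic_maps_def intro: continuous_map_compose)
    show "j ((g \<circ> u) w) = u w" if w: "w \<in> topspace T" for w
      using g continuous_map_image_subset_topspace[OF uS] w by (auto simp: homeomorphic_maps_def)
  qed
qed

lemma continuous_map_into_F:
  assumes "continuous_map W X x" "continuous_map (prod_topology interval W) Y \<gamma>"
    and "\<And>w. w \<in> topspace W \<Longrightarrow> \<gamma> (0, w) = f (x w)" "\<And>w. w \<in> topspace W \<Longrightarrow> \<gamma> (1, w) = y0"
  shows "continuous_map W hofib (\<lambda>w. (x w, adjoint_path \<gamma> w))"
  unfolding homotopy_fibre_def continuous_map_in_subtopology
  using assms by (simp add: continuous_map_pairedI continuous_map_adjoint_path)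

lemma continuous_map_from_F:
  assumes K: "continuous_map W hofib K"
  shows "continuous_map W X (\<lambda>w. fst (K w))"
    and "continuous_map (prod_topology interval W) Y (\<lambda>p. snd (K (snd p)) (fst p))"
    and "w \<in> topspace W \<Longrightarrow> snd (K w) 0 = f (fst (K w))" "w \<in> topspace W \<Longrightarrow> snd (K w) 1 = y0"
proof -
  have K': "continuous_map W (prod_topology X (path_space Y)) K"
    and im: "\<And>w. w \<in> topspace W \<Longrightarrow> snd (K w) 0 = f (fst (K w)) \<and> snd (K w) 1 = y0"
    using K by (auto simp: homotopy_fibre_def continuous_map_in_subtopology image_subset_iff Pi_iff
        case_prod_unfold)
  show "continuous_map W X (\<lambda>w. fst (K w))"
    using continuous_map_compose[OF K' continuous_map_fst] by (simp add: o_def)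
  have "continuous_map W (path_space Y) (\<lambda>w. snd (K w))"
    using continuous_map_compose[OF K' continuous_map_snd] by (simp add: o_def)
  then have "continuous_map (prod_topology interval W) Y
      (\<lambda>p. case (fst p, snd (K (snd p))) of (t, \<gamma>) \<Rightarrow> \<gamma> t)"
    by (intro continuous_map_compose_pair[OF continuous_map_path_eval] continuous_map_fst)
      (rule continuous_map_compose[OF continuous_map_snd, unfolded o_def])
  then show "continuous_map (prod_topology interval W) Y (\<lambda>p. snd (K (snd p)) (fst p))" by simp
  show "snd (K w) 0 = f (fst (K w))" "snd (K w) 1 = y0" if "w \<in> topspace W"
    using im[OF that] by auto
qed

lemma pointed_map_fibre_inclusion: "pointed_map Z z0 hofib (x0, const_path y0) (\<lambda>z. (j z, const_path y0))"
proof -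
  have "continuous_map Z hofib (\<lambda>z. (j z, adjoint_path (\<lambda>_. y0) z))"
    by (rule continuous_map_into_F) (auto simp: continuous_j)
  moreover have "adjoint_path (\<lambda>_. y0) z = const_path y0" for z :: 'z
    by (auto simp: adjoint_path_eq_const)
  ultimately show ?thesis by (simp add: pointed_map_def)
qed

text \<open>A homotopy in the homotopy fibre is a homotopy in \<open>X\<close> together with paths in \<open>Y\<close> from its image to the
  base point. Lift these paths: their end points lie in the fibre. At both ends of the homotopy and
  at \<open>w0\<close> the paths are constant; with a lift that is stationary there, the end points
  form a pointed homotopy between the given maps. The function \<open>\<psi>\<close> cuts out \<open>w0\<close>, as the height
  function of a sphere cuts out its base point.\<close>

lemma fibre_inclusion_reflects_homotopy:
  assumes \<psi>: "continuous_map W interval \<psi>" and \<psi>0: "\<And>w. w \<in> topspace W \<Longrightarrow> \<psi> w = 0 \<longleftrightarrow> w = w0"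
    and w0: "w0 \<in> topspace W"
    and z: "pointed_map W w0 Z z0 z" and z': "pointed_map W w0 Z z0 z'"
    and hom: "pointed_homotopic W w0 hofib (x0, const_path y0)
      (\<lambda>w. (j (z w), const_path y0)) (\<lambda>w. (j (z' w), const_path y0))"
  shows "pointed_homotopic W w0 Z z0 z z'"
proof -
  let ?IW = "prod_topology interval W"
  obtain K where K: "continuous_map ?IW hofib K" "\<And>w. K (0, w) = (j (z w), const_path y0)"
    "\<And>w. K (1, w) = (j (z' w), const_path y0)" "\<And>t. t \<in> {0..1} \<Longrightarrow> K (t, w0) = (x0, const_path y0)"
    using pointed_homotopicE[OF hom] by metis
  \<comment> \<open>vanishes exactly at the two ends of the homotopy and along the base point\<close>
  define \<phi> where "\<phi> = (\<lambda>p. fst p * (1 - fst p) * \<psi> (snd p))"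
  have "continuous_map ?IW euclideanreal fst"
    using continuous_map_fst[of interval W] by (simp add: continuous_map_interval_real)
  moreover have "continuous_map ?IW euclideanreal (\<lambda>p. \<psi> (snd p))"
    using continuous_map_compose[OF continuous_map_snd \<psi>] by (auto simp: continuous_map_interval_real o_def)
  moreover have "\<psi> w \<in> {0..1}" if "w \<in> topspace W" for w
    using \<psi> that by (auto simp: continuous_map_interval_real)
  ultimately have \<phi>: "continuous_map ?IW interval \<phi>"
    unfolding continuous_map_interval_real \<phi>_def
    by (auto intro!: continuous_intros mult_le_one)
  have stat: "K p = (fst (K p), const_path y0)"
    if "p \<in> topspace ?IW" "\<phi> p = 0" for p
    using that K(2-4) \<psi>0 by (auto simp: \<phi>_def)
  have stat': "(\<lambda>p. snd (K (snd p)) (fst p)) (t, p) = (\<lambda>p. snd (K (snd p)) (fst p)) (0, p)"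
    if "t \<in> {0..1}" "p \<in> topspace ?IW" "\<phi> p = 0" for t p
  proof -
    have "snd (K p) = const_path y0" using stat[OF that(2,3)] by (metis snd_conv)
    then show ?thesis using that(1) by (simp add: const_path_def)
  qed
  have start: "(\<lambda>p. snd (K (snd p)) (fst p)) (0, p) = f (fst (K p))" if "p \<in> topspace ?IW" for p
    using continuous_map_from_F(3)[OF K(1) that] by simp
  obtain H where H: "continuous_map (prod_topology interval ?IW) X H"
    "\<And>p. p \<in> topspace ?IW \<Longrightarrow> H (0, p) = fst (K p)"
    "\<And>t p. t \<in> {0..1} \<Longrightarrow> p \<in> topspace ?IW \<Longrightarrow> f (H (t, p)) = (\<lambda>p. snd (K (snd p)) (fst p)) (t, p)"
    "\<And>t p. t \<in> {0..1} \<Longrightarrow> p \<in> topspace ?IW \<Longrightarrow> \<phi> p = 0 \<Longrightarrow> H (t, p) = fst (K p)"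
    using hurewicz_fibration_lift_stationary[OF hurewicz_f continuous_map_from_F(1,2)[OF K(1)] start \<phi> stat']
    by blast
  have "continuous_map ?IW X (\<lambda>p. H (1, p))"
    by (rule continuous_map_compose_pair[OF H(1)]) auto
  moreover have "f (H (1, p)) = y0" if "p \<in> topspace ?IW" for p
    using H(3)[of 1, OF _ that] continuous_map_from_F(4)[OF K(1) that] by simp
  ultimately obtain k where k: "continuous_map ?IW Z k"
    "\<And>p. p \<in> topspace ?IW \<Longrightarrow> j (k p) = H (1, p)"
    by (rule map_into_fibre) blast+
  have kZ: "k p \<in> topspace Z" if "p \<in> topspace ?IW" for p
    using continuous_map_image_subset_topspace[OF k(1)] that by blast
  have zZ: "z w \<in> topspace Z" "z' w \<in> topspace Z" if "w \<in> topspace W" for w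
    using z z' that unfolding pointed_map_def continuous_map_def by auto
  show ?thesis
  proof (rule pointed_homotopicI[OF k(1) w0])
    show "k (0, w) = z w" if "w \<in> topspace W" for w
      by (rule j_inject) (use that kZ zZ k(2) H(4)[of 1 "(0, w)"] K(2) in \<open>auto simp: \<phi>_def\<close>)
    show "k (1, w) = z' w" if "w \<in> topspace W" for w
      by (rule j_inject) (use that kZ zZ k(2) H(4)[of 1 "(1, w)"] K(3) in \<open>auto simp: \<phi>_def\<close>)
    show "k (t, w0) = z0" if t: "t \<in> {0..1}" for t
    proof (rule j_inject)
      have p: "(t, w0) \<in> topspace ?IW" using t w0 by simp
      have "H (1, (t, w0)) = x0"
        using H(4)[of 1 "(t, w0)"] p K(4)[OF t] \<psi>0[OF w0] by (simp add: \<phi>_def)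
      then show "j (k (t, w0)) = j z0" using k(2)[OF p] by simp
    qed (use kZ t w0 in auto)
  qed
qed

lemma fibre_inclusion_homotopic_iff:
  assumes "pointed_map (nsphere m) sphere_base Z z0 g" "pointed_map (nsphere m) sphere_base Z z0 g'"
  shows "pointed_homotopic (nsphere m) sphere_base hofib (x0, const_path y0)
      (\<lambda>s. (j (g s), const_path y0)) (\<lambda>s. (j (g' s), const_path y0))
    \<longleftrightarrow> pointed_homotopic (nsphere m) sphere_base Z z0 g g'"
proof
  assume "pointed_homotopic (nsphere m) sphere_base Z z0 g g'"
  from pointed_homotopic_postcompose[OF this pointed_map_fibre_inclusion]
  show "pointed_homotopic (nsphere m) sphere_base hofib (x0, const_path y0)
      (\<lambda>s. (j (g s), const_path y0)) (\<lambda>s. (j (g' s), const_path y0))" by (simp add: o_def)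
next
  assume hom: "pointed_homotopic (nsphere m) sphere_base hofib (x0, const_path y0)
      (\<lambda>s. (j (g s), const_path y0)) (\<lambda>s. (j (g' s), const_path y0))"
  show "pointed_homotopic (nsphere m) sphere_base Z z0 g g'"
    by (rule fibre_inclusion_reflects_homotopy[OF continuous_map_sphere_height _ sphere_base_in_nsphere assms hom])
      (use nsphere_eq_base_iff in auto)
qed

text \<open>The homotopy in the homotopy fibre moves along \<open>H\<close>: at time \<open>t\<close> it consists of the point \<open>H (t, w)\<close> and
  of the image under \<open>f\<close> of the part of \<open>H (-, w)\<close> that is still ahead.\<close>

lemma endpoint_of_lift:
  assumes H: "continuous_map (prod_topology interval W) X H" and w0: "w0 \<in> topspace W"
    and Hw0: "\<And>t. t \<in> {0..1} \<Longrightarrow> H (t, w0) = x0"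
    and z: "pointed_map W w0 Z z0 z" "\<And>w. w \<in> topspace W \<Longrightarrow> j (z w) = H (1, w)"
  shows "pointed_homotopic W w0 hofib (x0, const_path y0)
    (\<lambda>w. (H (0, w), adjoint_path (\<lambda>p. f (H p)) w)) (\<lambda>w. (j (z w), const_path y0))"
proof (rule pointed_homotopicI[OF _ w0])
  let ?IW = "prod_topology interval W"
  let ?c = "\<lambda>(t, p). fst p + t * (1 - fst p)"
  let ?\<gamma> = "\<lambda>(t, p). f (H (?c (t, p), snd p))"
  have r: "continuous_map (prod_topology interval ?IW) euclideanreal fst"
    "continuous_map (prod_topology interval ?IW) euclideanreal (\<lambda>q. fst (snd q))"
    using continuous_map_fst[of interval ?IW]
      continuous_map_compose[OF continuous_map_snd continuous_map_fst, of interval interval W]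
    by (simp_all add: continuous_map_interval_real o_def)
  have c_le: "s + t * (1 - s) \<le> 1" if "s \<in> {0..1}" "t \<in> {0..1}" for s t :: real
    using mult_left_le[of t "1 - s"] that by (simp add: mult.commute)
  have c: "continuous_map (prod_topology interval ?IW) interval (\<lambda>q. fst (snd q) + fst q * (1 - fst (snd q)))"
    unfolding continuous_map_interval_real
    using c_le by (auto intro!: continuous_intros r)
  have snd2: "continuous_map (prod_topology interval ?IW) W (\<lambda>q. snd (snd q))"
    using continuous_map_compose[OF continuous_map_snd continuous_map_snd, of interval interval W]
    by (simp add: o_def)
  have "continuous_map (prod_topology interval ?IW) Y (\<lambda>q. f (H (fst (snd q) + fst q * (1 - fst (snd q)), snd (snd q))))"
    using continuous_map_compose[OF continuous_map_compose_pair[OF H c snd2] continuous_f]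
    by (simp add: o_def)
  then have \<gamma>: "continuous_map (prod_topology interval ?IW) Y ?\<gamma>" by (simp add: case_prod_unfold)
  have zZ: "z w \<in> topspace Z" if "w \<in> topspace W" for w
    using z that unfolding pointed_map_def continuous_map_def by auto
  show "continuous_map ?IW hofib (\<lambda>p. (H p, adjoint_path ?\<gamma> p))"
    by (rule continuous_map_into_F[OF H \<gamma>]) (auto simp: zZ simp flip: z(2))
  fix w assume w: "w \<in> topspace W"
  show "(H (0, w), adjoint_path ?\<gamma> (0, w)) = (H (0, w), adjoint_path (\<lambda>p. f (H p)) w)"
    by (auto intro: adjoint_path_cong)
  show "(H (1, w), adjoint_path ?\<gamma> (1, w)) = (j (z w), const_path y0)"
    using w by (auto intro!: adjoint_path_eq_const simp: zZ simp flip: z(2))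
next
  fix t :: real assume t: "t \<in> {0..1}"
  have c: "t + u * (1 - t) \<in> {0..1}" if "u \<in> {0..1}" for u
    using mult_left_le[of u "1 - t"] that t by (auto simp add: mult.commute)
  show "(H (t, w0), adjoint_path (\<lambda>(t, p). f (H ((\<lambda>(t, p). fst p + t * (1 - fst p)) (t, p), snd p))) (t, w0))
      = (x0, const_path y0)"
    using t c by (auto intro!: adjoint_path_eq_const simp: Hw0)
qed

lemma lift_into_fibre_end:
  assumes g: "pointed_map (nsphere m) sphere_base X x0 g"
    and h: "continuous_map (prod_topology interval (nsphere m)) Y h"
    and start: "\<And>s. s \<in> topspace (nsphere m) \<Longrightarrow> h (0, s) = f (g s)"
    and finish: "\<And>s. s \<in> topspace (nsphere m) \<Longrightarrow> h (1, s) = y0"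
    and base: "\<And>t. t \<in> {0..1} \<Longrightarrow> h (t, sphere_base) = y0"
  obtains H z where "continuous_map (prod_topology interval (nsphere m)) X H"
    "\<And>s. s \<in> topspace (nsphere m) \<Longrightarrow> H (0, s) = g s"
    "\<And>t s. t \<in> {0..1} \<Longrightarrow> s \<in> topspace (nsphere m) \<Longrightarrow> f (H (t, s)) = h (t, s)"
    "\<And>t. t \<in> {0..1} \<Longrightarrow> H (t, sphere_base) = x0"
    "pointed_map (nsphere m) sphere_base Z z0 z"
    "\<And>s. s \<in> topspace (nsphere m) \<Longrightarrow> j (z s) = H (1, s)"
proof -
  let ?S = "nsphere m"
  define \<phi> where "\<phi> = (\<lambda>s::nat \<Rightarrow> real. (1 - s 0) / 2)"
  have \<phi>: "continuous_map ?S interval \<phi>" unfolding \<phi>_def by (rule continuous_map_sphere_height)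
  have \<phi>0: "\<phi> s = 0 \<longleftrightarrow> s = sphere_base" if "s \<in> topspace ?S" for s
    using nsphere_eq_base_iff[OF that] by (simp add: \<phi>_def)
  have g': "continuous_map ?S X g" "g sphere_base = x0" using g by (simp_all add: pointed_map_def)
  have stat: "h (t, s) = h (0, s)" if "t \<in> {0..1}" "s \<in> topspace ?S" "\<phi> s = 0" for t s
    using that \<phi>0 base[of t] base[of 0] by simp
  obtain H where H: "continuous_map (prod_topology interval ?S) X H"
    "\<And>s. s \<in> topspace ?S \<Longrightarrow> H (0, s) = g s"
    "\<And>t s. t \<in> {0..1} \<Longrightarrow> s \<in> topspace ?S \<Longrightarrow> f (H (t, s)) = h (t, s)"
    "\<And>t s. t \<in> {0..1} \<Longrightarrow> s \<in> topspace ?S \<Longrightarrow> \<phi> s = 0 \<Longrightarrow> H (t, s) = g s"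
    using hurewicz_fibration_lift_stationary[OF hurewicz_f g'(1) h start \<phi> stat] by blast
  have Hb: "H (t, sphere_base) = x0" if "t \<in> {0..1}" for t
    using H(4)[OF that, of sphere_base] \<phi>0 g'(2) by simp
  have "continuous_map ?S X (\<lambda>s. H (1, s))" by (rule continuous_map_compose_pair[OF H(1)]) auto
  moreover have "f (H (1, s)) = y0" if "s \<in> topspace ?S" for s
    using H(3)[of 1 s] that finish by simp
  ultimately obtain z where z: "continuous_map ?S Z z" "\<And>s. s \<in> topspace ?S \<Longrightarrow> j (z s) = H (1, s)"
    by (rule map_into_fibre) blast+
  have "z sphere_base = z0"
  proof (rule j_inject)
    show "z sphere_base \<in> topspace Z" using z(1) unfolding continuous_map_def by auto
  qed (use z(2) Hb[of 1] in auto)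
  then have "pointed_map ?S sphere_base Z z0 z" using z(1) by (simp add: pointed_map_def)
  then show thesis using that H(1-3) Hb z(2) by blast
qed

text \<open>The data from which the boundary \<open>[z]\<close> of \<open>[a]\<close> is computed.\<close>

definition boundary_lift ::
    "nat \<Rightarrow> ((nat \<Rightarrow> real) \<Rightarrow> 'y) \<Rightarrow> (real \<times> (nat \<Rightarrow> real) \<Rightarrow> 'x) \<Rightarrow> ((nat \<Rightarrow> real) \<Rightarrow> 'z) \<Rightarrow> bool"
  where "boundary_lift m a H z \<longleftrightarrow>
    continuous_map (prod_topology interval (nsphere m)) X H \<and>
    (\<forall>s \<in> topspace (nsphere m). H (0, s) = x0) \<and>
    (\<forall>t \<in> {0..1}. H (t, sphere_base) = x0) \<and>
    (\<forall>t \<in> {0..1}. \<forall>s \<in> topspace (nsphere m). f (H (t, s)) = a (sphere_susp m s t)) \<and>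
    pointed_map (nsphere m) sphere_base Z z0 z \<and>
    (\<forall>s \<in> topspace (nsphere m). j (z s) = H (1, s))"

lemma connecting_hom_boundary_lift:
  "connecting_hom (Suc m) Z z0 j X x0 f A
    = {g. \<exists>a\<in>A. \<exists>H z. boundary_lift m a H z \<and> g \<in> sphere_class m Z z0 z}"
  by (simp add: connecting_hom_def boundary_lift_def conj_ac)

lemma boundary_lift_exists:
  assumes a: "pointed_map (nsphere (Suc m)) sphere_base Y y0 a"
  obtains H z where "boundary_lift m a H z"
proof -
  let ?h = "\<lambda>(t, s). a (sphere_susp m s t)"
  have const: "pointed_map (nsphere m) sphere_base X x0 (\<lambda>_. x0)" by (simp add: pointed_map_def)
  have h: "continuous_map (prod_topology interval (nsphere m)) Y ?h"
    using a by (intro continuous_map_on_suspension) (simp add: pointed_map_def)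
  have a0: "a sphere_base = y0" using a by (simp add: pointed_map_def)
  obtain H z where "continuous_map (prod_topology interval (nsphere m)) X H"
    "\<And>s. s \<in> topspace (nsphere m) \<Longrightarrow> H (0, s) = x0"
    "\<And>t s. t \<in> {0..1} \<Longrightarrow> s \<in> topspace (nsphere m) \<Longrightarrow> f (H (t, s)) = ?h (t, s)"
    "\<And>t. t \<in> {0..1} \<Longrightarrow> H (t, sphere_base) = x0"
    "pointed_map (nsphere m) sphere_base Z z0 z"
    "\<And>s. s \<in> topspace (nsphere m) \<Longrightarrow> j (z s) = H (1, s)"
    by (rule lift_into_fibre_end[OF const h]) (simp_all add: a0)
  then have "boundary_lift m a H z" by (simp add: boundary_lift_def)
  then show thesis by (rule that)
qed

text \<open>This expresses the boundary without reference to a lift, and thereby makes it accessible to homotopy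
  invariance.\<close>

lemma boundary_lift_homotopic:
  assumes "boundary_lift m a H z"
  shows "pointed_homotopic (nsphere m) sphere_base hofib (x0, const_path y0)
    (\<lambda>s. (j (z s), const_path y0)) (\<lambda>s. (x0, susp_adjoint m a s))"
proof -
  have H: "continuous_map (prod_topology interval (nsphere m)) X H"
    "\<And>s. s \<in> topspace (nsphere m) \<Longrightarrow> H (0, s) = x0" "\<And>t. t \<in> {0..1} \<Longrightarrow> H (t, sphere_base) = x0"
    "\<And>t s. t \<in> {0..1} \<Longrightarrow> s \<in> topspace (nsphere m) \<Longrightarrow> f (H (t, s)) = a (sphere_susp m s t)"
    "pointed_map (nsphere m) sphere_base Z z0 z"
    "\<And>s. s \<in> topspace (nsphere m) \<Longrightarrow> j (z s) = H (1, s)"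
    using assms by (auto simp: boundary_lift_def)
  have 1: "pointed_homotopic (nsphere m) sphere_base hofib (x0, const_path y0)
      (\<lambda>s. (H (0, s), adjoint_path (\<lambda>p. f (H p)) s)) (\<lambda>s. (j (z s), const_path y0))"
    by (rule endpoint_of_lift) (use H in auto)
  have "pointed_homotopic (nsphere m) sphere_base hofib (x0, const_path y0)
      (\<lambda>s. (H (0, s), adjoint_path (\<lambda>p. f (H p)) s)) (\<lambda>s. (x0, susp_adjoint m a s))"
  proof (rule pointed_homotopic_eq[OF pointed_homotopic_imp_pointed_map(1)[OF 1]])
    fix s assume s: "s \<in> topspace (nsphere m)"
    show "(H (0, s), adjoint_path (\<lambda>p. f (H p)) s) = (x0, susp_adjoint m a s)"
      using s H(2) by (auto simp: susp_adjoint_def H(4) intro!: adjoint_path_cong)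
  qed simp
  with pointed_homotopic_sym[OF 1] show ?thesis by (rule pointed_homotopic_trans)
qed

lemma susp_adjoint_homotopic:
  assumes "pointed_homotopic (nsphere (Suc m)) sphere_base Y y0 a b"
  shows "pointed_homotopic (nsphere m) sphere_base hofib (x0, const_path y0)
    (\<lambda>s. (x0, susp_adjoint m a s)) (\<lambda>s. (x0, susp_adjoint m b s))"
proof -
  let ?IS = "prod_topology interval (nsphere m)"
  obtain h where h: "continuous_map (prod_topology interval (nsphere (Suc m))) Y h"
    "\<And>s. h (0, s) = a s" "\<And>s. h (1, s) = b s" "\<And>t. t \<in> {0..1} \<Longrightarrow> h (t, sphere_base) = y0"
    using pointed_homotopicE[OF assms] by blast
  let ?\<gamma> = "\<lambda>(u, p). h (fst p, sphere_susp m (snd p) u)"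
  have p: "continuous_map (prod_topology interval ?IS) interval (\<lambda>q. fst (snd q))"
    "continuous_map (prod_topology interval ?IS) (nsphere m) (\<lambda>q. snd (snd q))"
    using continuous_map_compose[OF continuous_map_snd continuous_map_fst, of interval interval "nsphere m"]
      continuous_map_compose[OF continuous_map_snd continuous_map_snd, of interval interval "nsphere m"]
    by (simp_all add: o_def)
  have "continuous_map (prod_topology interval ?IS) (nsphere (Suc m))
      (\<lambda>q. case (fst q, snd (snd q)) of (t, s) \<Rightarrow> sphere_susp m s t)"
    by (rule continuous_map_compose_pair[OF continuous_map_sphere_susp continuous_map_fst p(2)])
  then have "continuous_map (prod_topology interval ?IS) Y
      (\<lambda>q. h (fst (snd q), case (fst q, snd (snd q)) of (t, s) \<Rightarrow> sphere_susp m s t))"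
    by (rule continuous_map_compose_pair[OF h(1) p(1)])
  then have \<gamma>: "continuous_map (prod_topology interval ?IS) Y ?\<gamma>" by (simp add: case_prod_unfold)
  show ?thesis
  proof (rule pointed_homotopicI)
    show "continuous_map ?IS hofib (\<lambda>p. (x0, adjoint_path ?\<gamma> p))"
      by (rule continuous_map_into_F[OF _ \<gamma>]) (auto simp: h(4))
  qed (auto simp: susp_adjoint_def h intro!: adjoint_path_cong adjoint_path_eq_const)
qed

text \<open>From left to right, homotopic \<open>a\<close> and \<open>a'\<close> have homotopic adjoints. From right to left, compare \<open>g\<close> with the
  end \<open>z\<close> of some lift of \<open>a\<close>: both become homotopic to the adjoint of \<open>a\<close> in the homotopy fibre,
  so they are homotopic in the fibre.\<close>

lemma connecting_hom_class:
  assumes a: "pointed_map (nsphere (Suc m)) sphere_base Y y0 a"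
  shows "connecting_hom (Suc m) Z z0 j X x0 f (sphere_class (Suc m) Y y0 a)
    = {g. pointed_map (nsphere m) sphere_base Z z0 g \<and>
        pointed_homotopic (nsphere m) sphere_base hofib (x0, const_path y0)
          (\<lambda>s. (j (g s), const_path y0)) (\<lambda>s. (x0, susp_adjoint m a s))}" (is "?L = ?R")
proof (intro equalityI subsetI)
  fix g assume "g \<in> ?L"
  then obtain a' H z where a': "pointed_homotopic (nsphere (Suc m)) sphere_base Y y0 a a'"
    and lift: "boundary_lift m a' H z" and g: "pointed_homotopic (nsphere m) sphere_base Z z0 z g"
    by (auto simp: connecting_hom_boundary_lift sphere_class_def)
  have "pointed_homotopic (nsphere m) sphere_base hofib (x0, const_path y0)
      (\<lambda>s. (j (g s), const_path y0)) (\<lambda>s. (j (z s), const_path y0))"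
    using pointed_homotopic_postcompose[OF pointed_homotopic_sym[OF g] pointed_map_fibre_inclusion] by (simp add: o_def)
  also note boundary_lift_homotopic[OF lift]
  also note susp_adjoint_homotopic[OF pointed_homotopic_sym[OF a']]
  finally show "g \<in> ?R" using pointed_homotopic_imp_pointed_map(2)[OF g] by simp
next
  fix g assume "g \<in> ?R"
  then have g: "pointed_map (nsphere m) sphere_base Z z0 g"
    and hom: "pointed_homotopic (nsphere m) sphere_base hofib (x0, const_path y0)
      (\<lambda>s. (j (g s), const_path y0)) (\<lambda>s. (x0, susp_adjoint m a s))" by auto
  obtain H z where lift: "boundary_lift m a H z" using boundary_lift_exists[OF a] .
  then have z: "pointed_map (nsphere m) sphere_base Z z0 z" by (simp add: boundary_lift_def)
  note boundary_lift_homotopic[OF lift]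
  also note pointed_homotopic_sym[OF hom]
  finally have "pointed_homotopic (nsphere m) sphere_base hofib (x0, const_path y0)
      (\<lambda>s. (j (z s), const_path y0)) (\<lambda>s. (j (g s), const_path y0))" .
  then have "pointed_homotopic (nsphere m) sphere_base Z z0 z g"
    by (simp only: fibre_inclusion_homotopic_iff[OF z g])
  then have "g \<in> sphere_class m Z z0 z" by (simp add: sphere_class_def)
  moreover have "a \<in> sphere_class (Suc m) Y y0 a" using a by (simp add: sphere_class_def)
  ultimately show "g \<in> ?L" unfolding connecting_hom_boundary_lift using lift by blast
qed

end


section \<open>Homotopy classes of maps of spheres\<close>

lemma self_in_sphere_class: "pointed_map (nsphere n) sphere_base Y y0 a \<Longrightarrow> a \<in> sphere_class n Y y0 a"
  by (simp add: sphere_class_def)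

lemma sphere_class_eqI:
  "pointed_homotopic (nsphere n) sphere_base Y y0 a b \<Longrightarrow> sphere_class n Y y0 a = sphere_class n Y y0 b"
  unfolding sphere_class_def
  by (intro Collect_cong iffI) (blast intro: pointed_homotopic_trans pointed_homotopic_sym)+

lemma sphere_class_eq_iff:
  assumes "pointed_map (nsphere n) sphere_base Y y0 b"
  shows "sphere_class n Y y0 a = sphere_class n Y y0 b \<longleftrightarrow> pointed_homotopic (nsphere n) sphere_base Y y0 a b"
proof
  assume "sphere_class n Y y0 a = sphere_class n Y y0 b"
  then have "b \<in> sphere_class n Y y0 a" using self_in_sphere_class[OF assms] by simp
  then show "pointed_homotopic (nsphere n) sphere_base Y y0 a b" by (simp add: sphere_class_def)
qed (rule sphere_class_eqI)

lemma carrier_homotopy_group: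
  "carrier (homotopy_group n Y y0) = sphere_class n Y y0 ` {a. pointed_map (nsphere n) sphere_base Y y0 a}"
  by (simp add: homotopy_group_def)

lemma one_homotopy_group: "\<one>\<^bsub>homotopy_group n Y y0\<^esub> = sphere_class n Y y0 (\<lambda>_. y0)"
  by (simp add: homotopy_group_def)

lemma pointed_map_const [simp]: "pointed_map W w0 Y y0 (\<lambda>_. y0) \<longleftrightarrow> W = trivial_topology \<or> y0 \<in> topspace Y"
  by (simp add: pointed_map_def)

lemma homotopy_group_map_class:
  assumes p: "pointed_map X x0 Y y0 p" and a: "pointed_map (nsphere n) sphere_base X x0 a"
  shows "homotopy_group_map n Y y0 p (sphere_class n X x0 a) = sphere_class n Y y0 (p \<circ> a)"
proof -
  have "sphere_class n Y y0 (p \<circ> b) = sphere_class n Y y0 (p \<circ> a)" if "b \<in> sphere_class n X x0 a" for b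
    using that pointed_homotopic_postcompose[OF pointed_homotopic_sym p]
    by (auto simp: sphere_class_def[of _ X] intro!: sphere_class_eqI)
  then show ?thesis
    unfolding homotopy_group_map_def using self_in_sphere_class[OF a] by blast
qed


section \<open>The long exact sequence\<close>

context fibre_sequence
begin

lemma connecting_hom_eq_class_iff:
  assumes a: "pointed_map (nsphere (Suc m)) sphere_base Y y0 a"
    and g: "pointed_map (nsphere m) sphere_base Z z0 g"
  shows "connecting_hom (Suc m) Z z0 j X x0 f (sphere_class (Suc m) Y y0 a) = sphere_class m Z z0 g
    \<longleftrightarrow> pointed_homotopic (nsphere m) sphere_base hofib (x0, const_path y0)
          (\<lambda>s. (j (g s), const_path y0)) (\<lambda>s. (x0, susp_adjoint m a s))" (is "?L = _ \<longleftrightarrow> ?hom")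
proof
  assume "?L = sphere_class m Z z0 g"
  then have "g \<in> ?L" using self_in_sphere_class[OF g] by simp
  then show ?hom using connecting_hom_class[OF a] by simp
next
  assume hom: ?hom
  have "g' \<in> ?L \<longleftrightarrow> g' \<in> sphere_class m Z z0 g" for g'
  proof (cases "pointed_map (nsphere m) sphere_base Z z0 g'")
    case True
    have "g' \<in> ?L \<longleftrightarrow> pointed_homotopic (nsphere m) sphere_base hofib (x0, const_path y0)
          (\<lambda>s. (j (g' s), const_path y0)) (\<lambda>s. (x0, susp_adjoint m a s))"
      using connecting_hom_class[OF a] True by simp
    also have "\<dots> \<longleftrightarrow> pointed_homotopic (nsphere m) sphere_base hofib (x0, const_path y0)
          (\<lambda>s. (j (g s), const_path y0)) (\<lambda>s. (j (g' s), const_path y0))"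
      using hom pointed_homotopic_trans pointed_homotopic_sym by meson
    finally show ?thesis using fibre_inclusion_homotopic_iff[OF g True] by (simp add: sphere_class_def)
  next
    case False
    then have "g' \<notin> sphere_class m Z z0 g"
      by (auto simp: sphere_class_def dest: pointed_homotopic_imp_pointed_map(2))
    then show ?thesis using connecting_hom_class[OF a] False by simp
  qed
  then show "?L = sphere_class m Z z0 g" by blast
qed

lemma connecting_hom_lift:
  assumes "pointed_map (nsphere (Suc m)) sphere_base Y y0 a" "boundary_lift m a H z"
  shows "connecting_hom (Suc m) Z z0 j X x0 f (sphere_class (Suc m) Y y0 a) = sphere_class m Z z0 z"
  using connecting_hom_eq_class_iff[OF assms(1)] boundary_lift_homotopic[OF assms(2)] assms(2)
  by (simp add: boundary_lift_def)

text \<open>A lift as in the definition of the boundary of \<open>[a]\<close> is the same as a null homotopy of \<open>j \<circ> z\<close>: given the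
  null homotopy, \<open>a\<close> is the map of the suspension induced by its image in \<open>Y\<close>.\<close>

lemma exact_at_fibre:
  "connecting_hom (Suc m) Z z0 j X x0 f ` carrier (homotopy_group (Suc m) Y y0)
    = {A \<in> carrier (homotopy_group m Z z0). homotopy_group_map m X x0 j A = sphere_class m X x0 (\<lambda>_. x0)}"
    (is "?L = ?R")
proof (intro equalityI subsetI)
  fix B assume "B \<in> ?L"
  then obtain a where a: "pointed_map (nsphere (Suc m)) sphere_base Y y0 a"
    and B: "B = connecting_hom (Suc m) Z z0 j X x0 f (sphere_class (Suc m) Y y0 a)"
    by (auto simp: carrier_homotopy_group)
  obtain H z where lift: "boundary_lift m a H z" using boundary_lift_exists[OF a] .
  then have z: "pointed_map (nsphere m) sphere_base Z z0 z" by (simp add: boundary_lift_def)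
  have "pointed_homotopic (nsphere m) sphere_base X x0 (\<lambda>_. x0) (j \<circ> z)"
    by (rule pointed_homotopicI[of _ _ H]) (use lift in \<open>auto simp: boundary_lift_def\<close>)
  then have "homotopy_group_map m X x0 j (sphere_class m Z z0 z) = sphere_class m X x0 (\<lambda>_. x0)"
    using homotopy_group_map_class[OF pointed_map_j z] sphere_class_eqI by metis
  then show "B \<in> ?R" using B connecting_hom_lift[OF a lift] z by (auto simp: carrier_homotopy_group)
next
  fix B assume "B \<in> ?R"
  then obtain z where z: "pointed_map (nsphere m) sphere_base Z z0 z" and B: "B = sphere_class m Z z0 z"
    and "homotopy_group_map m X x0 j (sphere_class m Z z0 z) = sphere_class m X x0 (\<lambda>_. x0)"
    by (auto simp: carrier_homotopy_group)
  then have "pointed_homotopic (nsphere m) sphere_base X x0 (j \<circ> z) (\<lambda>_. x0)"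
    using homotopy_group_map_class[OF pointed_map_j z] sphere_class_eq_iff[of m X x0 "\<lambda>_. x0"] by simp
  from pointed_homotopic_sym[OF this] obtain H where
    H: "continuous_map (prod_topology interval (nsphere m)) X H" "\<And>s. H (0, s) = x0"
    "\<And>s. H (1, s) = (j \<circ> z) s" "\<And>t. t \<in> {0..1} \<Longrightarrow> H (t, sphere_base) = x0"
    by (rule pointed_homotopicE) blast
  have zZ: "z s \<in> topspace Z" if "s \<in> topspace (nsphere m)" for s
    using z that unfolding pointed_map_def continuous_map_def by auto
  have "continuous_map (prod_topology interval (nsphere m)) Y (f \<circ> H)"
    by (rule continuous_map_compose[OF H(1) continuous_f])
  then obtain a where a: "pointed_map (nsphere (Suc m)) sphere_base Y y0 a"
    "\<And>t s. t \<in> {0..1} \<Longrightarrow> s \<in> topspace (nsphere m) \<Longrightarrow> a (sphere_susp m s t) = (f \<circ> H) (t, s)"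
    by (rule map_descends_to_suspension[where ?y0.0 = y0]) (use H zZ in auto)
  then have "boundary_lift m a H z"
    unfolding boundary_lift_def using H z by simp
  then show "B \<in> ?L" using connecting_hom_lift[OF a(1)] B a(1) by (auto simp: carrier_homotopy_group)
qed

lemma exact_at_total_space:
  "homotopy_group_map m X x0 j ` carrier (homotopy_group m Z z0)
    = {A \<in> carrier (homotopy_group m X x0). homotopy_group_map m Y y0 f A = sphere_class m Y y0 (\<lambda>_. y0)}"
    (is "?L = ?R")
proof (intro equalityI subsetI)
  fix B assume "B \<in> ?L"
  then obtain z where z: "pointed_map (nsphere m) sphere_base Z z0 z"
    and B: "B = sphere_class m X x0 (j \<circ> z)"
    by (auto simp: carrier_homotopy_group homotopy_group_map_class[OF pointed_map_j])
  have jz: "pointed_map (nsphere m) sphere_base X x0 (j \<circ> z)" by (rule pointed_map_compose[OF z pointed_map_j])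
  have zZ: "z s \<in> topspace Z" if "s \<in> topspace (nsphere m)" for s
    using z that unfolding pointed_map_def continuous_map_def by auto
  have "pointed_homotopic (nsphere m) sphere_base Y y0 (f \<circ> (j \<circ> z)) (\<lambda>_. y0)"
    by (rule pointed_homotopic_eq[OF pointed_map_compose[OF jz pointed_map_f]]) (auto simp: zZ)
  then have "homotopy_group_map m Y y0 f B = sphere_class m Y y0 (\<lambda>_. y0)"
    unfolding B homotopy_group_map_class[OF pointed_map_f jz] by (rule sphere_class_eqI)
  then show "B \<in> ?R" using B jz by (auto simp: carrier_homotopy_group)
next
  let ?S = "nsphere m"
  fix B assume "B \<in> ?R"
  then obtain a where a: "pointed_map ?S sphere_base X x0 a" and B: "B = sphere_class m X x0 a"
    and "homotopy_group_map m Y y0 f (sphere_class m X x0 a) = sphere_class m Y y0 (\<lambda>_. y0)"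
    by (auto simp: carrier_homotopy_group)
  then have "pointed_homotopic ?S sphere_base Y y0 (f \<circ> a) (\<lambda>_. y0)"
    using homotopy_group_map_class[OF pointed_map_f a] sphere_class_eq_iff[of m Y y0 "\<lambda>_. y0"] by simp
  then obtain h where h: "continuous_map (prod_topology interval ?S) Y h" "\<And>s. h (0, s) = (f \<circ> a) s"
    "\<And>s. h (1, s) = y0" "\<And>t. t \<in> {0..1} \<Longrightarrow> h (t, sphere_base) = y0"
    by (rule pointed_homotopicE) blast
  obtain H z where H: "continuous_map (prod_topology interval ?S) X H"
    "\<And>s. s \<in> topspace ?S \<Longrightarrow> H (0, s) = a s"
    "\<And>t s. t \<in> {0..1} \<Longrightarrow> s \<in> topspace ?S \<Longrightarrow> f (H (t, s)) = h (t, s)"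
    "\<And>t. t \<in> {0..1} \<Longrightarrow> H (t, sphere_base) = x0"
    and z': "pointed_map ?S sphere_base Z z0 z"
    and z: "\<And>s. s \<in> topspace ?S \<Longrightarrow> j (z s) = H (1, s)"
    by (rule lift_into_fibre_end[OF a h(1)]) (use h in simp_all)
  have "pointed_homotopic ?S sphere_base X x0 a (j \<circ> z)"
    by (rule pointed_homotopicI[OF H(1)]) (use H z in auto)
  then have "B = homotopy_group_map m X x0 j (sphere_class m Z z0 z)"
    unfolding B homotopy_group_map_class[OF pointed_map_j z'] by (rule sphere_class_eqI)
  then show "B \<in> ?L" using z' by (auto simp: carrier_homotopy_group)
qed

lemma boundary_lift_of_composition:
  assumes b: "pointed_map (nsphere (Suc m)) sphere_base X x0 b"
  shows "boundary_lift m (f \<circ> b) (\<lambda>(t, s). b (sphere_susp m s t)) (\<lambda>_. z0)"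
  unfolding boundary_lift_def
  using b continuous_map_on_suspension[of m X b] by (auto simp: pointed_map_def)

text \<open>For fixed \<open>s\<close>, the null homotopy is a square \<open>\<gamma> (\<tau>, t, s)\<close> in \<open>Y\<close>. On the side \<open>t = 0\<close> it is \<open>a\<close> along the
  circle through \<open>s\<close>, on the side \<open>\<tau> = 0\<close> it is the image under \<open>f\<close> of a loop in \<open>X\<close>, and on the other
  two sides it is constant. These loops in \<open>X\<close> form the map \<open>b\<close>. Running through the square from the
  common corner of the first two sides along straight lines to all points of the other two deforms \<open>a\<close>
  into \<open>f \<circ> b\<close>.\<close>

lemma null_boundary_lifts:
  assumes a: "pointed_map (nsphere (Suc m)) sphere_base Y y0 a"
    and null: "pointed_homotopic (nsphere m) sphere_base hofib (x0, const_path y0)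
      (\<lambda>s. (x0, susp_adjoint m a s)) (\<lambda>s. (x0, const_path y0))"
  obtains b where "pointed_map (nsphere (Suc m)) sphere_base X x0 b"
    "pointed_homotopic (nsphere (Suc m)) sphere_base Y y0 a (f \<circ> b)"
proof -
  let ?S = "nsphere m" and ?IS = "prod_topology interval (nsphere m)"
  obtain K where K: "continuous_map ?IS hofib K" "\<And>s. K (0, s) = (x0, susp_adjoint m a s)"
    "\<And>s. K (1, s) = (x0, const_path y0)" "\<And>t. t \<in> {0..1} \<Longrightarrow> K (t, sphere_base) = (x0, const_path y0)"
    using pointed_homotopicE[OF null] by blast
  note KF = continuous_map_from_F[OF K(1)]
  obtain b where b: "pointed_map (nsphere (Suc m)) sphere_base X x0 b"
    "\<And>t s. t \<in> {0..1} \<Longrightarrow> s \<in> topspace ?S \<Longrightarrow> b (sphere_susp m s t) = fst (K (t, s))"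
    by (rule map_descends_to_suspension[OF KF(1), where ?y0.0 = x0]) (use K in auto)
  define \<gamma> where "\<gamma> = (\<lambda>(\<tau>, p). snd (K p) \<tau>)"
  have \<gamma>: "continuous_map (prod_topology interval ?IS) Y \<gamma>"
    using KF(2) by (simp add: \<gamma>_def case_prod_unfold)
  have const: "const_path y0 \<tau> = y0" if "\<tau> \<in> {0..1}" for \<tau> :: real
    using that by (simp add: const_path_def)
  \<comment> \<open>for \<open>0 \<le> u \<le> 1\<close>, the end point at \<open>v = 1\<close> moves from \<open>(\<tau>, t) = (1, 0)\<close> via \<open>(1, 1)\<close> to \<open>(0, 1)\<close>\<close>
  define G where "G = (\<lambda>(u, v, s). \<gamma> (min 1 (2 * (1 - u)) * v, min 1 (2 * u) * v, s))"
  have r: "continuous_map (prod_topology interval ?IS) euclideanreal fst"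
    "continuous_map (prod_topology interval ?IS) euclideanreal (\<lambda>q. fst (snd q))"
    "continuous_map (prod_topology interval ?IS) ?S (\<lambda>q. snd (snd q))"
    using continuous_map_fst[of interval ?IS]
      continuous_map_compose[OF continuous_map_snd continuous_map_fst, of interval interval ?S]
      continuous_map_compose[OF continuous_map_snd continuous_map_snd, of interval interval ?S]
    by (simp_all add: continuous_map_interval_real o_def)
  have "continuous_map (prod_topology interval ?IS) interval (\<lambda>q. min 1 (2 * (1 - fst q)) * fst (snd q))"
    "continuous_map (prod_topology interval ?IS) interval (\<lambda>q. min 1 (2 * fst q) * fst (snd q))"
    unfolding continuous_map_interval_real
    by (auto intro!: continuous_intros r mult_le_one)
  then have "continuous_map (prod_topology interval ?IS) Y
      (\<lambda>q. \<gamma> (min 1 (2 * (1 - fst q)) * fst (snd q), (min 1 (2 * fst q) * fst (snd q), snd (snd q))))"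
    by (intro continuous_map_compose_pair[OF \<gamma>] continuous_map_pairedI r(3))
  then have G: "continuous_map (prod_topology interval ?IS) Y G"
    by (simp add: G_def case_prod_unfold)
  have a0: "a sphere_base = y0" using a by (simp add: pointed_map_def)
  have G0: "G (u, 0, s) = y0" for u s
    by (simp add: G_def \<gamma>_def K(2) a0)
  have G1: "G (u, 1, s) = y0" if "u \<in> {0..1}" "s \<in> topspace ?S" for u s
  proof (cases "u \<le> 1 / 2")
    case True
    then show ?thesis using KF(4)[of "(2 * u, s)"] that by (simp add: G_def \<gamma>_def)
  next
    case False
    then show ?thesis using that by (simp add: G_def \<gamma>_def K(3) const)
  qed
  have Gb: "G (u, t, sphere_base) = y0" if "u \<in> {0..1}" "t \<in> {0..1}" for u t
  proof -
    have "min 1 (2 * (1 - u)) * t \<in> {0..1}" "min 1 (2 * u) * t \<in> {0..1}"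
      using that by (auto intro: mult_le_one)
    then show ?thesis by (simp add: G_def \<gamma>_def K(4) const)
  qed
  obtain h where h: "continuous_map (prod_topology interval (nsphere (Suc m))) Y h"
    "\<And>u t s. u \<in> {0..1} \<Longrightarrow> t \<in> {0..1} \<Longrightarrow> s \<in> topspace ?S \<Longrightarrow> h (u, sphere_susp m s t) = G (u, t, s)"
    "\<And>u. u \<in> {0..1} \<Longrightarrow> h (u, sphere_base) = y0"
    by (rule homotopy_descends_to_suspension[OF G, where ?y0.0 = y0]) (use G0 G1 Gb in auto)
  have susp: "\<exists>t\<in>{0..1}. \<exists>s\<in>topspace ?S. p = sphere_susp m s t" if "p \<in> topspace (nsphere (Suc m))" for p
    using that by (auto simp flip: sphere_susp_image)
  have "pointed_homotopic (nsphere (Suc m)) sphere_base Y y0 a (f \<circ> b)"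
  proof (rule pointed_homotopicI[OF h(1)])
    fix p assume "p \<in> topspace (nsphere (Suc m))"
    then obtain t s where p: "t \<in> {0..1}" "s \<in> topspace ?S" "p = sphere_susp m s t" using susp by blast
    show "h (0, p) = a p"
      using h(2)[of 0 t s] p by (simp add: G_def \<gamma>_def K(2))
    show "h (1, p) = (f \<circ> b) p"
      using h(2)[of 1 t s] p KF(3)[of "(t, s)"] b(2) by (simp add: G_def \<gamma>_def)
  qed (use h(3) in auto)
  then show thesis using that b(1) by blast
qed

lemma exact_at_base:
  "homotopy_group_map (Suc m) Y y0 f ` carrier (homotopy_group (Suc m) X x0)
    = {A \<in> carrier (homotopy_group (Suc m) Y y0).
        connecting_hom (Suc m) Z z0 j X x0 f A = sphere_class m Z z0 (\<lambda>_. z0)}" (is "?L = ?R")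
proof (intro equalityI subsetI)
  fix B assume "B \<in> ?L"
  then obtain b where b: "pointed_map (nsphere (Suc m)) sphere_base X x0 b"
    and B: "B = sphere_class (Suc m) Y y0 (f \<circ> b)"
    by (auto simp: carrier_homotopy_group homotopy_group_map_class[OF pointed_map_f])
  have fb: "pointed_map (nsphere (Suc m)) sphere_base Y y0 (f \<circ> b)"
    by (rule pointed_map_compose[OF b pointed_map_f])
  then show "B \<in> ?R"
    using B connecting_hom_lift[OF fb boundary_lift_of_composition[OF b]] by (auto simp: carrier_homotopy_group)
next
  fix B assume "B \<in> ?R"
  then obtain a where a: "pointed_map (nsphere (Suc m)) sphere_base Y y0 a" and B: "B = sphere_class (Suc m) Y y0 a"
    and "connecting_hom (Suc m) Z z0 j X x0 f (sphere_class (Suc m) Y y0 a) = sphere_class m Z z0 (\<lambda>_. z0)"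
    by (auto simp: carrier_homotopy_group)
  then have "pointed_homotopic (nsphere m) sphere_base hofib (x0, const_path y0)
      (\<lambda>s. (x0, const_path y0)) (\<lambda>s. (x0, susp_adjoint m a s))"
    using connecting_hom_eq_class_iff[OF a, of "\<lambda>_. z0"] by simp
  from null_boundary_lifts[OF a pointed_homotopic_sym[OF this]] obtain b
    where b: "pointed_map (nsphere (Suc m)) sphere_base X x0 b"
      "pointed_homotopic (nsphere (Suc m)) sphere_base Y y0 a (f \<circ> b)" by blast
  then have "B = homotopy_group_map (Suc m) Y y0 f (sphere_class (Suc m) X x0 b)"
    unfolding B homotopy_group_map_class[OF pointed_map_f b(1)] by (intro sphere_class_eqI)
  then show "B \<in> ?L" using b(1) by (auto simp: carrier_homotopy_group)
qed

end


section \<open>Path connectedness\<close>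

lemma topspace_closed_disc:
  "topspace (closed_disc n) = {v. (\<forall>i\<ge>n. v i = 0) \<and> (\<Sum>i<n. (v i)\<^sup>2) \<le> 1}"
  by (auto simp: closed_disc_def topspace_Euclidean_space)

lemma closed_disc_eq: "closed_disc n = subtopology (powertop_real UNIV) (topspace (closed_disc n))"
  by (simp add: topspace_closed_disc closed_disc_def Euclidean_space_def subtopology_subtopology Collect_conj_eq)

lemma compact_closed_disc: "compact_space (closed_disc n)"
proof -
  have proj: "continuous_map (powertop_real UNIV) euclideanreal (\<lambda>v. v i)" for i
    by (intro continuous_map_product_projection) simp
  have "continuous_map (powertop_real UNIV) euclideanreal (\<lambda>v. \<Sum>i<n. (v i)\<^sup>2)"
    by (intro continuous_intros proj) auto
  from closedin_continuous_map_preimage[OF this, of "{..1}"]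
  have "closedin (powertop_real UNIV) {v. (\<Sum>i<n. (v i)\<^sup>2) \<le> 1}" by simp
  then have closed: "closedin (powertop_real UNIV) (topspace (closed_disc n))"
    using closedin_Int[OF closedin_Euclidean_space[of n]]
    by (simp add: topspace_closed_disc topspace_Euclidean_space Collect_conj_eq)
  have "v i \<in> {-1..1}" if v: "v \<in> topspace (closed_disc n)" for v i
  proof (cases "i < n")
    case True
    have "(v i)\<^sup>2 \<le> (\<Sum>i<n. (v i)\<^sup>2)" by (rule member_le_sum) (use True in auto)
    also have "\<dots> \<le> 1" using v by (simp add: topspace_closed_disc)
    finally have "\<bar>v i\<bar> \<le> 1" by (simp add: abs_square_le_1)
    then show ?thesis by auto
  next
    case False
    then show ?thesis using v by (simp add: topspace_closed_disc)
  qed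
  then have sub: "topspace (closed_disc n) \<subseteq> (\<Pi>\<^sub>E i\<in>UNIV. {-1..1})" by auto
  have "compactin (powertop_real UNIV) (\<Pi>\<^sub>E i\<in>UNIV. {-1..1})"
    unfolding compactin_PiE by simp
  then have "compactin (powertop_real UNIV) (topspace (closed_disc n))"
    using closed sub closed_compactin by blast
  then show ?thesis by (subst closed_disc_eq) (rule compact_space_subtopology)
qed

lemma path_connected_closed_disc: "path_connected_space (closed_disc n)"
proof -
  have *: "path_component_of (closed_disc n) (\<lambda>_. 0) v" if v: "v \<in> topspace (closed_disc n)" for v
    unfolding path_component_of_def
  proof (intro exI conjI)
    have "(\<Sum>i<n. (t * v i)\<^sup>2) \<le> 1" if "t \<in> {0..1}" for t
    proof -
      have "t\<^sup>2 \<le> 1" using that by (simp add: power_le_one)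
      have "(\<Sum>i<n. (t * v i)\<^sup>2) = t\<^sup>2 * (\<Sum>i<n. (v i)\<^sup>2)" by (simp add: power_mult_distrib sum_distrib_left)
      also have "\<dots> \<le> 1" using \<open>t\<^sup>2 \<le> 1\<close> v by (intro mult_le_one) (auto simp: topspace_closed_disc sum_nonneg)
      finally show ?thesis .
    qed
    moreover have "continuous_map interval (powertop_real UNIV) (\<lambda>t i. t * v i)"
      unfolding continuous_map_componentwise_UNIV by (auto intro!: continuous_intros)
    ultimately show "pathin (closed_disc n) (\<lambda>t i. t * v i)"
      unfolding pathin_def using v
      by (subst closed_disc_eq) (auto simp: continuous_map_in_subtopology topspace_closed_disc)
  qed auto
  show ?thesis
    unfolding path_connected_space_iff_path_component
  proof (intro ballI)
    fix x y assume "x \<in> topspace (closed_disc n)" "y \<in> topspace (closed_disc n)"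
    from path_component_of_trans[OF path_component_of_sym[OF *[OF this(1)]] *[OF this(2)]]
    show "path_component_of (closed_disc n) x y" .
  qed
qed

text \<open>A closed cell is closed, being compact, and it is path connected. So a set that is a union of path
  components contains it or misses it, and such a set is closed in the weak topology. This applies to a path
  component and to its complement alike.\<close>

lemma CW_complex_saturated_closed:
  assumes C: "cw_structure X C" and S: "S \<subseteq> topspace X"
    and sat: "\<And>x y. x \<in> S \<Longrightarrow> path_component_of X x y \<Longrightarrow> y \<in> S"
  shows "closedin X S"
proof -
  note C = C[unfolded cw_structure_def]
  have haus: "Hausdorff_space X" using C by (elim conjE)
  have cells: "\<forall>(n, \<Phi>)\<in>C. continuous_map (closed_disc n) X \<Phi> \<and>
      embedding_map (subtopology (closed_disc n) (disc_interior n)) X \<Phi>"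
    using C by (elim conjE)
  have weak: "\<forall>A\<subseteq>topspace X. (\<forall>c\<in>C. closedin X (A \<inter> closed_cell c)) \<longrightarrow> closedin X A"
    using C by (elim conjE)
  show ?thesis
  proof (rule weak[rule_format, OF S])
    fix c assume c: "c \<in> C"
    obtain n \<Phi> where [simp]: "c = (n, \<Phi>)" by (cases c)
    have \<Phi>: "continuous_map (closed_disc n) X \<Phi>" using cells c by auto
    have cell: "closed_cell c = \<Phi> ` topspace (closed_disc n)" by (simp add: closed_cell_def)
    have "closedin X (closed_cell c)"
      unfolding cell using haus compact_closed_disc \<Phi>
      by (meson compact_space_def compactin_imp_closedin image_compactin)
    moreover have "S \<inter> closed_cell c = {} \<or> S \<inter> closed_cell c = closed_cell c"
    proof -
      have "y \<in> S" if x: "x \<in> S" "x \<in> closed_cell c" and y: "y \<in> closed_cell c" for x y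
      proof -
        have "path_connectedin X (closed_cell c)"
          unfolding cell using path_connected_closed_disc \<Phi>
          by (meson path_connectedin_continuous_map_image path_connectedin_topspace)
        then have "path_component_of X x y"
          using x(2) y by (meson path_component_of path_connectedin_topspace)
        then show ?thesis by (rule sat[OF x(1)])
      qed
      then show ?thesis by blast
    qed
    ultimately show "closedin X (S \<inter> closed_cell c)" by auto
  qed
qed

lemma homotopic_imp_path_component:
  assumes "homotopic_with (\<lambda>_. True) X Y p q" "x \<in> topspace X"
  shows "path_component_of Y (p x) (q x)"
proof -
  obtain h where h: "continuous_map (prod_topology interval X) Y h" "\<And>x. h (0, x) = p x" "\<And>x. h (1, x) = q x"
    using assms(1) unfolding homotopic_with_def by blast
  have "continuous_map interval Y (\<lambda>t. h (t, x))"
    by (rule continuous_map_compose_pair[OF h(1)]) (use assms(2) in auto)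
  then show ?thesis unfolding path_component_of_def pathin_def using h(2,3) by metis
qed

text \<open>In the CW complex the path components are open and closed, so the image of a connected space lies in
  one of them. The homotopy from \<open>q \<circ> p\<close> to the identity joins every point of \<open>Z\<close> to the
  image of the complex.\<close>

lemma path_connected_of_CW_homotopy_type:
  assumes K: "CW_complex K" and eqv: "Z homotopy_equivalent_space K" and Z: "connected_space Z"
  shows "path_connected_space Z"
proof -
  obtain p q where p: "continuous_map Z K p" and q: "continuous_map K Z q"
    and qp: "homotopic_with (\<lambda>_. True) Z Z (q \<circ> p) id"
    using eqv unfolding homotopy_equivalent_space_def by blast
  obtain C where C: "cw_structure K C" using K unfolding CW_complex_def by blast
  have pK: "p z \<in> topspace K" if "z \<in> topspace Z" for z
    using continuous_map_image_subset_topspace[OF p] that by blast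
  have comp: "path_component_of K (p z) (p z')" if z: "z \<in> topspace Z" and z': "z' \<in> topspace Z" for z z'
  proof -
    let ?S = "{k \<in> topspace K. path_component_of K (p z) k}"
    have "closedin K ?S"
      by (rule CW_complex_saturated_closed[OF C])
        (auto dest: path_component_of_trans path_component_in_topspace)
    moreover have "closedin K (topspace K - ?S)"
      by (rule CW_complex_saturated_closed[OF C])
        (auto dest: path_component_of_trans path_component_of_sym path_component_in_topspace)
    ultimately have "closedin K ?S" "openin K ?S" by (auto simp: openin_closedin_eq)
    then have "closedin Z {w \<in> topspace Z. p w \<in> ?S}" "openin Z {w \<in> topspace Z. p w \<in> ?S}"
      using closedin_continuous_map_preimage[OF p] openin_continuous_map_preimage[OF p] by blast+
    then have "{w \<in> topspace Z. p w \<in> ?S} = {} \<or> {w \<in> topspace Z. p w \<in> ?S} = topspace Z"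
      using Z unfolding connected_space_clopen_in by blast
    moreover have "z \<in> {w \<in> topspace Z. p w \<in> ?S}" using z pK by (simp add: path_component_of_refl)
    ultimately have "z' \<in> {w \<in> topspace Z. p w \<in> ?S}" using z' by blast
    then show ?thesis by simp
  qed
  have "path_component_of Z z z'" if z: "z \<in> topspace Z" and z': "z' \<in> topspace Z" for z z'
  proof -
    obtain g where "pathin K g" "g 0 = p z" "g 1 = p z'"
      using comp[OF z z'] unfolding path_component_of_def by blast
    then have qp_path: "path_component_of Z (q (p z)) (q (p z'))"
      unfolding path_component_of_def
      by (intro exI[of _ "q \<circ> g"]) (auto simp: pathin_def intro: continuous_map_compose q)
    have retract: "path_component_of Z (q (p w)) w" if "w \<in> topspace Z" for w
      using homotopic_imp_path_component[OF qp that] by simp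
    show ?thesis
      by (rule path_component_of_trans[OF path_component_of_sym[OF retract[OF z]]
            path_component_of_trans[OF qp_path retract[OF z']]])
  qed
  then show ?thesis by (simp add: path_connected_space_iff_path_component)
qed

lemma path_connected_null_homotopic_0_sphere:
  assumes Z: "path_connected_space Z" and g: "pointed_map (nsphere 0) sphere_base Z z0 g"
  shows "pointed_homotopic (nsphere 0) sphere_base Z z0 (\<lambda>_. z0) g"
proof -
  let ?e = "\<lambda>i. - sphere_base i :: real"
  have e: "?e \<in> topspace (nsphere 0)" by (simp add: in_nsphere_iff sphere_base_def)
  have gZ: "g s \<in> topspace Z" if "s \<in> topspace (nsphere 0)" for s
    using g that unfolding pointed_map_def continuous_map_def by auto
  have gb: "g sphere_base = z0" using g by (simp add: pointed_map_def)
  then have z0: "z0 \<in> topspace Z" using gZ[of sphere_base] by simp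
  obtain c where c: "continuous_map interval Z c" "c 0 = z0" "c 1 = g ?e"
    using Z z0 gZ[OF e] unfolding path_connected_space_def pathin_def by blast
  let ?P = "prod_topology interval (nsphere 0)"
  have coord: "continuous_map ?P euclideanreal (\<lambda>p. snd p 0)"
    using continuous_map_compose[OF continuous_map_snd continuous_map_nsphere_projection] by (simp add: o_def)
  have base0: "sphere_base 0 = 1" by (simp add: sphere_base_def)
  have "continuous_map ?P Z (\<lambda>p. if snd p 0 \<le> 0 then c (fst p) else z0)"
  proof (rule continuous_map_cases_le[OF coord])
    show "continuous_map (subtopology ?P {x. x \<in> topspace ?P \<and> snd x 0 \<le> 0}) Z (\<lambda>p. c (fst p))"
      using continuous_map_compose[OF continuous_map_fst c(1), of "nsphere 0"]
      by (intro continuous_map_from_subtopology) (simp add: o_def)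
    show "c (fst p) = z0" if "p \<in> topspace ?P" "snd p 0 = 0" for p
      using that nsphere_0_cases[of "snd p"] base0 by auto
  qed (simp_all add: z0)
  then show ?thesis
  proof (rule pointed_homotopicI)
    fix s assume "s \<in> topspace (nsphere 0)"
    then have "s = sphere_base \<or> s = ?e" by (rule nsphere_0_cases)
    then show "(if snd (0, s) 0 \<le> 0 then c (fst (0, s)) else z0) = z0"
      "(if snd (1, s) 0 \<le> 0 then c (fst (1, s)) else z0) = g s"
      using c gb base0 by auto
  qed (simp_all add: base0)
qed


section \<open>Concatenation of maps of spheres\<close>

abbreviation cube_space :: "nat \<Rightarrow> (nat \<Rightarrow> real) topology"
  where "cube_space n \<equiv> subtopology (powertop_real UNIV) (cube n)"

lemma continuous_map_cube_coordinate:
  "continuous_map (cube_space n) euclideanreal (\<lambda>u. u i)"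
  by (intro continuous_map_from_subtopology continuous_map_product_projection) simp

lemma compact_space_cube: "compact_space (cube_space n)"
proof -
  have "cube n = (\<Pi>\<^sub>E i\<in>UNIV. if i < n then {0..1} else {0})"
    by (force simp: cube_def PiE_def Pi_def not_less)
  moreover have "compactin (powertop_real UNIV) (\<Pi>\<^sub>E i\<in>UNIV. if i < n then {0..1} else {0})"
    unfolding compactin_PiE by simp
  ultimately show ?thesis by (simp only: compact_space_subtopology)
qed

lemma cube_to_sphere_in_nsphere: "cube_to_sphere n u \<in> topspace (nsphere n)"
proof (induction n)
  case 0
  then show ?case by (auto simp: in_nsphere_iff sphere_base_def)
qed (simp add: sphere_susp_in_nsphere)

lemma cube_to_sphere_cong: "(\<And>i. i < n \<Longrightarrow> u i = v i) \<Longrightarrow> cube_to_sphere n u = cube_to_sphere n v"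
  by (induction n) auto

lemma continuous_map_cube_to_sphere:
  assumes "n \<le> N"
  shows "continuous_map (cube_space N) (nsphere n) (cube_to_sphere n)"
  using assms
proof (induction n)
  case 0
  have "(\<lambda>i. - sphere_base i) \<in> topspace (nsphere 0)"
    using cube_to_sphere_in_nsphere[of 0] by simp
  then show ?case by (simp add: cube_to_sphere.simps(1)[abs_def])
next
  case (Suc n)
  have "continuous_map (cube_space N) interval (\<lambda>u. u n)"
    unfolding continuous_map_interval_real
    by (rule conjI[OF continuous_map_cube_coordinate]) (use Suc.prems in \<open>auto simp: cube_def\<close>)
  then have "continuous_map (cube_space N) (nsphere (Suc n))
      (\<lambda>u. case (u n, cube_to_sphere n u) of (t, s) \<Rightarrow> sphere_susp n s t)"
    using Suc by (intro continuous_map_compose_pair[OF continuous_map_sphere_susp]) auto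
  then show ?case by simp
qed

lemma cube_to_sphere_eq_base_iff:
  assumes "\<And>i. i < n \<Longrightarrow> u i \<in> {0..1}"
  shows "cube_to_sphere n u = sphere_base \<longleftrightarrow> (\<exists>i<n. u i \<in> {0, 1})"
  using assms
proof (induction n)
  case 0
  then show ?case by (auto simp: sphere_base_def fun_eq_iff)
next
  case (Suc n)
  have "cube_to_sphere (Suc n) u = sphere_base \<longleftrightarrow> cube_to_sphere n u = sphere_base \<or> u n \<in> {0, 1}"
    using sphere_susp_eq_base_iff[OF cube_to_sphere_in_nsphere, of "u n" n u] Suc.prems[of n] by auto
  then show ?case using Suc by (auto simp: less_Suc_eq)
qed

lemma cube_to_sphere_boundary:
  assumes "u \<in> cube n" "i < n" "u i \<in> {0, 1}"
  shows "cube_to_sphere n u = sphere_base"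
  by (rule iffD2[OF cube_to_sphere_eq_base_iff]) (use assms in \<open>auto simp: cube_def\<close>)

lemma cube_to_sphere_inj:
  assumes "\<And>i. i < n \<Longrightarrow> u i \<in> {0..1}" "\<And>i. i < n \<Longrightarrow> v i \<in> {0..1}"
    and "cube_to_sphere n u = cube_to_sphere n v" "cube_to_sphere n u \<noteq> sphere_base" "i < n"
  shows "u i = v i"
  using assms
proof (induction n arbitrary: i)
  case (Suc n)
  have eq: "cube_to_sphere n u = cube_to_sphere n v \<and> u n = v n"
    using sphere_susp_inj[OF cube_to_sphere_in_nsphere cube_to_sphere_in_nsphere, of "u n" "v n" n u v] Suc.prems
    by auto
  have ne: "cube_to_sphere n u \<noteq> sphere_base" using Suc.prems(4) by auto
  show ?case
  proof (cases "i = n")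
    case True
    then show ?thesis using eq by simp
  next
    case False
    then have "i < n" using Suc.prems(5) by simp
    with Suc.prems(1,2) eq ne show ?thesis by (intro Suc.IH) simp_all
  qed
qed simp

lemma cube_to_sphere_surj:
  assumes "p \<in> topspace (nsphere n)" "p \<noteq> sphere_base \<or> n \<ge> 1"
  shows "\<exists>u\<in>cube n. cube_to_sphere n u = p"
proof -
  have "\<exists>u\<in>cube n. cube_to_sphere n u = p" if "p \<in> topspace (nsphere n)" "p \<noteq> sphere_base" for p n
    using that
  proof (induction n arbitrary: p)
    case 0
    then have "cube_to_sphere 0 (\<lambda>_. 0) = p" using nsphere_0_cases by force
    then show ?case by (auto simp: cube_def)
  next
    case (Suc n)
    obtain s t where st: "s \<in> topspace (nsphere n)" "t \<in> {0..1}" "p = sphere_susp n s t"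
      using sphere_susp_surj[OF Suc.prems] .
    then have "s \<noteq> sphere_base" using Suc.prems(2) by auto
    then obtain u where u: "u \<in> cube n" "cube_to_sphere n u = s" using Suc.IH[OF st(1)] by blast
    have "cube_to_sphere n (u(n := t)) = s" using cube_to_sphere_cong[of n "u(n := t)" u] u(2) by simp
    then have "cube_to_sphere (Suc n) (u(n := t)) = p" using st(3) by simp
    moreover have "u(n := t) \<in> cube (Suc n)" using u(1) st(2) by (auto simp: cube_def)
    ultimately show ?case by blast
  qed
  moreover have "\<exists>u\<in>cube n. cube_to_sphere n u = sphere_base" if "n \<ge> 1"
  proof
    show "cube_to_sphere n (\<lambda>_. 0) = sphere_base"
      using that by (subst cube_to_sphere_eq_base_iff) (auto simp: Suc_le_eq)
  qed (simp add: cube_def)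
  ultimately show ?thesis using assms by blast
qed

definition interval_reparam :: "(real \<Rightarrow> real) \<Rightarrow> bool"
  where "interval_reparam \<theta> \<longleftrightarrow> continuous_on UNIV \<theta> \<and> \<theta> ` {0..1} \<subseteq> {0..1} \<and> \<theta> ` {0, 1} \<subseteq> {0, 1}"

text \<open>The map of \<open>S\<^sup>n\<close> that is induced by the map \<open>\<theta>\<close> of the first coordinate of the cube. For \<open>n \<ge> 1\<close> its
  values on the cube determine it, so the choice is immaterial.\<close>

definition sphere_reparam :: "nat \<Rightarrow> (real \<Rightarrow> real) \<Rightarrow> (nat \<Rightarrow> real) \<Rightarrow> nat \<Rightarrow> real"
  where "sphere_reparam n \<theta> = (SOME q. pointed_map (nsphere n) sphere_base (nsphere n) sphere_base q \<and>
    (\<forall>u\<in>cube n. q (cube_to_sphere n u) = cube_to_sphere n (u(0 := \<theta> (u 0)))))"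

text \<open>The map \<open>\<theta>\<close> sends end points to end points, so the map of the cube preserves the boundary, which is
  all that \<open>cube_to_sphere\<close> collapses.\<close>

lemma sphere_reparam:
  assumes \<theta>: "interval_reparam \<theta>" and n: "n \<ge> 1"
  shows "pointed_map (nsphere n) sphere_base (nsphere n) sphere_base (sphere_reparam n \<theta>)"
    and "u \<in> cube n \<Longrightarrow> sphere_reparam n \<theta> (cube_to_sphere n u) = cube_to_sphere n (u(0 := \<theta> (u 0)))"
proof -
  let ?g = "\<lambda>u::nat \<Rightarrow> real. u(0 := \<theta> (u 0))"
  have g_cube: "?g u \<in> cube n" if "u \<in> cube n" for u
  proof -
    have "u 0 \<in> {0..1}" using that n by (auto simp: cube_def)
    then have "\<theta> (u 0) \<in> {0..1}" using \<theta> unfolding interval_reparam_def by blast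
    then show ?thesis using that n by (auto simp: cube_def)
  qed
  have quot: "quotient_map (cube_space n) (nsphere n) (cube_to_sphere n)"
  proof (rule continuous_imp_quotient_map)
    show "cube_to_sphere n ` topspace (cube_space n) = topspace (nsphere n)"
      using cube_to_sphere_surj[of _ n] n cube_to_sphere_in_nsphere by (auto 4 3)
  qed (simp_all add: continuous_map_cube_to_sphere compact_space_cube)
  have "continuous_map (cube_space n) euclideanreal (\<lambda>u. ?g u i)" for i
  proof (cases "i = 0")
    case True
    have "continuous_map (cube_space n) euclideanreal (\<theta> \<circ> (\<lambda>u. u 0))"
      by (rule continuous_map_compose[OF continuous_map_cube_coordinate])
        (use \<theta> in \<open>simp add: interval_reparam_def\<close>)
    then show ?thesis using True by (simp add: o_def)
  qed (simp add: continuous_map_cube_coordinate)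
  then have "continuous_map (cube_space n) (cube_space n) ?g"
    using g_cube by (simp add: continuous_map_in_subtopology continuous_map_componentwise_UNIV image_subset_iff_funcset)
  then have cont: "continuous_map (cube_space n) (nsphere n) (\<lambda>u. cube_to_sphere n (?g u))"
    using continuous_map_compose[OF _ continuous_map_cube_to_sphere[of n n]] by (simp add: o_def)
  have compat: "cube_to_sphere n (?g u) = cube_to_sphere n (?g v)"
    if u: "u \<in> cube n" and v: "v \<in> cube n" and eq: "cube_to_sphere n u = cube_to_sphere n v" for u v
  proof (cases "cube_to_sphere n u = sphere_base")
    case True
    have "cube_to_sphere n (?g w) = sphere_base" if w: "w \<in> cube n" "cube_to_sphere n w = sphere_base" for w
    proof -
      obtain i where "i < n" "w i \<in> {0, 1}"
        using w cube_to_sphere_eq_base_iff[of n w] by (auto simp: cube_def)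
      then have "?g w i \<in> {0, 1}" using \<theta> by (auto simp: interval_reparam_def)
      with g_cube[OF w(1)] \<open>i < n\<close> show ?thesis by (rule cube_to_sphere_boundary)
    qed
    from this[OF u True] this[OF v] True eq show ?thesis by simp
  next
    case False
    then have "u i = v i" if "i < n" for i
      using cube_to_sphere_inj[of n u v i] u v eq that by (auto simp: cube_def)
    then show ?thesis using n by (intro cube_to_sphere_cong) auto
  qed
  obtain q where q: "continuous_map (nsphere n) (nsphere n) q"
    "\<And>u. u \<in> cube n \<Longrightarrow> q (cube_to_sphere n u) = cube_to_sphere n (?g u)"
  proof (rule quotient_map_lift_exists[OF quot cont])
    show "cube_to_sphere n (?g u) = cube_to_sphere n (?g v)"
      if "u \<in> topspace (cube_space n)" "v \<in> topspace (cube_space n)"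
        "cube_to_sphere n u = cube_to_sphere n v" for u v
      using that(1,2) by (intro compat that(3)) simp_all
  qed (use that in auto)
  have "q sphere_base = sphere_base"
  proof -
    have 0: "(\<lambda>_. 0) \<in> cube n" by (simp add: cube_def)
    have "cube_to_sphere n (\<lambda>_. 0) = sphere_base"
      by (rule cube_to_sphere_boundary[OF 0, of 0]) (use n in auto)
    moreover have "cube_to_sphere n (?g (\<lambda>_. 0)) = sphere_base"
      by (rule cube_to_sphere_boundary[OF g_cube[OF 0], of 0]) (use n \<theta> in \<open>auto simp: interval_reparam_def\<close>)
    ultimately show ?thesis using q(2)[OF 0] by simp
  qed
  then have "\<exists>q. pointed_map (nsphere n) sphere_base (nsphere n) sphere_base q \<and>
    (\<forall>u\<in>cube n. q (cube_to_sphere n u) = cube_to_sphere n (?g u))"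
    using q by (auto simp: pointed_map_def)
  from someI_ex[OF this]
  show "pointed_map (nsphere n) sphere_base (nsphere n) sphere_base (sphere_reparam n \<theta>)"
    "u \<in> cube n \<Longrightarrow> sphere_reparam n \<theta> (cube_to_sphere n u) = cube_to_sphere n (?g u)"
    unfolding sphere_reparam_def by blast+
qed

text \<open>The suspension coordinate is the last coordinate of the cube, and \<open>n \<ge> 1\<close> makes it different from the
  first one.\<close>

lemma sphere_reparam_susp:
  assumes \<theta>: "interval_reparam \<theta>" and n: "n \<ge> 1"
    and s: "s \<in> topspace (nsphere n)" and t: "t \<in> {0..1}"
  shows "sphere_reparam (Suc n) \<theta> (sphere_susp n s t) = sphere_susp n (sphere_reparam n \<theta> s) t"
proof -
  obtain u where u: "u \<in> cube n" "cube_to_sphere n u = s" using cube_to_sphere_surj[OF s] n by blast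
  have 1: "cube_to_sphere n (u(n := t)) = s"
    using cube_to_sphere_cong[of n "u(n := t)" u] u(2) by simp
  have 2: "cube_to_sphere n ((u(n := t))(0 := \<theta> (u 0))) = cube_to_sphere n (u(0 := \<theta> (u 0)))"
    by (rule cube_to_sphere_cong) auto
  have "u(n := t) \<in> cube (Suc n)" using u(1) t by (auto simp: cube_def)
  from sphere_reparam(2)[OF \<theta> _ this] n sphere_reparam(2)[OF \<theta> n u(1)]
  show ?thesis by (simp add: 1 2 u(2))
qed

text \<open>The two components of the pinch map from \<open>S\<^sup>n\<close> to \<open>S\<^sup>n \<or> S\<^sup>n\<close>, the wedge regarded as a subset of the
  product.\<close>

definition pinch_left :: "nat \<Rightarrow> (nat \<Rightarrow> real) \<Rightarrow> nat \<Rightarrow> real"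
  where "pinch_left n = sphere_reparam n (\<lambda>t. min 1 (2 * t))"

definition pinch_right :: "nat \<Rightarrow> (nat \<Rightarrow> real) \<Rightarrow> nat \<Rightarrow> real"
  where "pinch_right n = sphere_reparam n (\<lambda>t. max 0 (2 * t - 1))"

definition sphere_concat ::
    "nat \<Rightarrow> ((nat \<Rightarrow> real) \<Rightarrow> 'a) \<Rightarrow> ((nat \<Rightarrow> real) \<Rightarrow> 'a) \<Rightarrow> (nat \<Rightarrow> real) \<Rightarrow> 'a"
  where "sphere_concat n a b s = (if pinch_right n s = sphere_base then a (pinch_left n s) else b (pinch_right n s))"

lemma interval_reparam_pinch: "interval_reparam (\<lambda>t. min 1 (2 * t))" "interval_reparam (\<lambda>t. max 0 (2 * t - 1))"
  by (auto simp: interval_reparam_def intro!: continuous_intros)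

lemma pinch_susp:
  assumes "n \<ge> 1" "s \<in> topspace (nsphere n)" "t \<in> {0..1}"
  shows "pinch_left (Suc n) (sphere_susp n s t) = sphere_susp n (pinch_left n s) t"
    and "pinch_right (Suc n) (sphere_susp n s t) = sphere_susp n (pinch_right n s) t"
  using assms by (simp_all add: pinch_left_def pinch_right_def sphere_reparam_susp interval_reparam_pinch)

lemma pointed_map_pinch:
  assumes "n \<ge> 1"
  shows "pointed_map (nsphere n) sphere_base (nsphere n) sphere_base (pinch_left n)"
    and "pointed_map (nsphere n) sphere_base (nsphere n) sphere_base (pinch_right n)"
  using assms by (simp_all add: pinch_left_def pinch_right_def sphere_reparam(1) interval_reparam_pinch)

lemma pinch_in_nsphere:
  assumes "n \<ge> 1" "s \<in> topspace (nsphere n)"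
  shows "pinch_left n s \<in> topspace (nsphere n)" "pinch_right n s \<in> topspace (nsphere n)"
  using pointed_map_pinch[OF assms(1)] assms(2) unfolding pointed_map_def continuous_map_def by auto

lemma pinch_base:
  assumes "n \<ge> 1"
  shows "pinch_left n sphere_base = sphere_base" "pinch_right n sphere_base = sphere_base"
  using pointed_map_pinch[OF assms] by (simp_all add: pointed_map_def)

lemma pinch_cube_to_sphere:
  assumes "n \<ge> 1" "u \<in> cube n"
  shows "pinch_left n (cube_to_sphere n u) = (if u 0 \<le> 1/2 then cube_to_sphere n (u(0 := 2 * u 0)) else sphere_base)"
    and "pinch_right n (cube_to_sphere n u) = (if u 0 \<le> 1/2 then sphere_base else cube_to_sphere n (u(0 := 2 * u 0 - 1)))"
proof -
  have u: "u i \<in> {0..1}" if "i < n" for i using assms(2) that by (auto simp: cube_def)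
  have boundary: "cube_to_sphere n (u(0 := 1)) = sphere_base" "cube_to_sphere n (u(0 := 0)) = sphere_base"
    using cube_to_sphere_eq_base_iff[of n "u(0 := 1)"] cube_to_sphere_eq_base_iff[of n "u(0 := 0)"] u assms(1)
    by auto
  show "pinch_left n (cube_to_sphere n u) = (if u 0 \<le> 1/2 then cube_to_sphere n (u(0 := 2 * u 0)) else sphere_base)"
    unfolding pinch_left_def sphere_reparam(2)[OF interval_reparam_pinch(1) assms]
    by (auto simp: boundary)
  show "pinch_right n (cube_to_sphere n u) = (if u 0 \<le> 1/2 then sphere_base else cube_to_sphere n (u(0 := 2 * u 0 - 1)))"
    unfolding pinch_right_def sphere_reparam(2)[OF interval_reparam_pinch(2) assms]
    by (auto simp: boundary)
qed

lemma pinch_wedge: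
  assumes "n \<ge> 1" "s \<in> topspace (nsphere n)"
  shows "pinch_left n s = sphere_base \<or> pinch_right n s = sphere_base"
proof -
  obtain u where "u \<in> cube n" "cube_to_sphere n u = s" using cube_to_sphere_surj[OF assms(2)] assms(1) by blast
  then show ?thesis using pinch_cube_to_sphere[OF assms(1), of u] by auto
qed

lemma is_concat_iff:
  assumes n: "n \<ge> 1" and a: "a sphere_base = y0" and b: "b sphere_base = y0"
  shows "is_concat n a b c \<longleftrightarrow> (\<forall>s\<in>topspace (nsphere n). c s = sphere_concat n a b s)"
proof -
  have "sphere_concat n a b (cube_to_sphere n u) = (if u 0 \<le> 1/2 then a (cube_to_sphere n (u(0 := 2 * u 0)))
     else b (cube_to_sphere n (u(0 := 2 * u 0 - 1))))" if "u \<in> cube n" for u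
    using a b by (simp add: sphere_concat_def pinch_cube_to_sphere[OF n that])
  moreover have "(\<forall>s\<in>topspace (nsphere n). P s) \<longleftrightarrow> (\<forall>u\<in>cube n. P (cube_to_sphere n u))" for P
    using cube_to_sphere_surj[of _ n] cube_to_sphere_in_nsphere n by metis
  ultimately show ?thesis by (simp add: is_concat_def)
qed

text \<open>The two closed sets on which a component of the pinch map is the base point cover the sphere, and on
  their intersection both branches have the value \<open>y0\<close>. The space \<open>T\<close> is the time of a homotopy or
  of a lift.\<close>

lemma continuous_map_pinch_cases:
  assumes n: "n \<ge> 1" and h: "continuous_map (prod_topology T (nsphere n)) Y h"
    and k: "continuous_map (prod_topology T (nsphere n)) Y k"
    and base: "\<And>t. t \<in> topspace T \<Longrightarrow> h (t, sphere_base) = y0" "\<And>t. t \<in> topspace T \<Longrightarrow> k (t, sphere_base) = y0"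
  shows "continuous_map (prod_topology T (nsphere n)) Y
    (\<lambda>(t, s). if pinch_right n s = sphere_base then h (t, pinch_left n s) else k (t, pinch_right n s))"
proof (rule pasting_lemma_closed[where I = UNIV])
  let ?P = "prod_topology T (nsphere n)"
  let ?T = "\<lambda>i. {p \<in> topspace ?P. (if i then pinch_right n else pinch_left n) (snd p) \<in> {sphere_base}}"
  let ?f = "\<lambda>i p. if i then h (fst p, pinch_left n (snd p)) else k (fst p, pinch_right n (snd p))"
  show "finite (UNIV :: bool set)" by simp
  have pl: "continuous_map ?P (nsphere n) (\<lambda>p. pinch_left n (snd p))"
    and pr: "continuous_map ?P (nsphere n) (\<lambda>p. pinch_right n (snd p))"
    using pointed_map_pinch[OF n] continuous_map_compose[OF continuous_map_snd, of _ _ _ T]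
    by (auto simp: pointed_map_def o_def)
  have sing: "closedin (nsphere n) {sphere_base}"
    by (simp add: closedin_Hausdorff_singleton)
  show "closedin ?P (?T i)" for i
    using closedin_continuous_map_preimage[OF pl sing] closedin_continuous_map_preimage[OF pr sing]
    by (cases i) simp_all
  have "continuous_map ?P Y (\<lambda>p. h (fst p, pinch_left n (snd p)))"
    "continuous_map ?P Y (\<lambda>p. k (fst p, pinch_right n (snd p)))"
    by (intro continuous_map_compose_pair[OF h] continuous_map_compose_pair[OF k] continuous_map_fst pl pr)+
  then show "continuous_map (subtopology ?P (?T i)) Y (?f i)" for i
    by (cases i) (simp_all add: continuous_map_from_subtopology)
  show "?f i p = ?f i' p" if "p \<in> topspace ?P \<inter> ?T i \<inter> ?T i'" for i i' p
    using that by (cases i; cases i') (auto simp: base)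
  show "\<exists>i. i \<in> UNIV \<and> p \<in> ?T i \<and>
      (case p of (t, s) \<Rightarrow> if pinch_right n s = sphere_base then h (t, pinch_left n s) else k (t, pinch_right n s)) = ?f i p"
    if "p \<in> topspace ?P" for p
    using that pinch_wedge[OF n, of "snd p"]
    by (intro exI[of _ "pinch_right n (snd p) = sphere_base"]) (auto simp: case_prod_unfold)
qed

lemma sphere_concat_homotopic:
  assumes n: "n \<ge> 1" and "pointed_homotopic (nsphere n) sphere_base Y y0 a a'"
    and "pointed_homotopic (nsphere n) sphere_base Y y0 b b'"
  shows "pointed_homotopic (nsphere n) sphere_base Y y0 (sphere_concat n a b) (sphere_concat n a' b')"
proof -
  obtain h where h: "continuous_map (prod_topology interval (nsphere n)) Y h" "\<And>s. h (0, s) = a s"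
    "\<And>s. h (1, s) = a' s" "\<And>t. t \<in> {0..1} \<Longrightarrow> h (t, sphere_base) = y0"
    using pointed_homotopicE[OF assms(2)] by blast
  obtain k where k: "continuous_map (prod_topology interval (nsphere n)) Y k" "\<And>s. k (0, s) = b s"
    "\<And>s. k (1, s) = b' s" "\<And>t. t \<in> {0..1} \<Longrightarrow> k (t, sphere_base) = y0"
    using pointed_homotopicE[OF assms(3)] by blast
  show ?thesis
    by (rule pointed_homotopicI[OF continuous_map_pinch_cases[OF n h(1) k(1)]])
      (simp_all add: sphere_concat_def h k pinch_base[OF n])
qed

lemma pointed_map_sphere_concat:
  assumes "n \<ge> 1" "pointed_map (nsphere n) sphere_base Y y0 a" "pointed_map (nsphere n) sphere_base Y y0 b"
  shows "pointed_map (nsphere n) sphere_base Y y0 (sphere_concat n a b)"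
  using sphere_concat_homotopic[of n Y y0 a a b b] assms by simp

lemma mult_homotopy_group:
  assumes n: "n \<ge> 1" and a: "pointed_map (nsphere n) sphere_base Y y0 a" and b: "pointed_map (nsphere n) sphere_base Y y0 b"
  shows "sphere_class n Y y0 a \<otimes>\<^bsub>homotopy_group n Y y0\<^esub> sphere_class n Y y0 b = sphere_class n Y y0 (sphere_concat n a b)"
    (is "?L = ?R")
proof (intro equalityI subsetI)
  fix g assume "g \<in> ?L"
  then obtain a' b' c where a': "pointed_homotopic (nsphere n) sphere_base Y y0 a a'"
    and b': "pointed_homotopic (nsphere n) sphere_base Y y0 b b'"
    and c: "is_concat n a' b' c" and g: "g \<in> sphere_class n Y y0 c"
    by (auto simp: homotopy_group_def sphere_class_def)
  have eq: "\<forall>s\<in>topspace (nsphere n). c s = sphere_concat n a' b' s"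
    using c is_concat_iff[OF n, of a' y0 b'] pointed_homotopic_imp_pointed_map(2)[OF a']
      pointed_homotopic_imp_pointed_map(2)[OF b'] by (simp add: pointed_map_def)
  note hom = sphere_concat_homotopic[OF n a' b']
  also have "pointed_homotopic (nsphere n) sphere_base Y y0 (sphere_concat n a' b') c"
    by (rule pointed_homotopic_eq[OF pointed_homotopic_imp_pointed_map(2)[OF hom]]) (use eq in auto)
  finally show "g \<in> ?R" using g sphere_class_eqI by metis
next
  fix g assume g: "g \<in> ?R"
  have "is_concat n a b (sphere_concat n a b)"
    using is_concat_iff[OF n, of a y0 b] a b by (simp add: pointed_map_def)
  then show "g \<in> ?L"
    using g self_in_sphere_class[OF a] self_in_sphere_class[OF b] by (auto simp: homotopy_group_def)
qed

lemma homotopy_group_map_hom: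
  assumes n: "n \<ge> 1" and p: "pointed_map X x0 Y y0 p"
  shows "homotopy_group_map n Y y0 p \<in> hom (homotopy_group n X x0) (homotopy_group n Y y0)"
proof (rule homI)
  fix A assume "A \<in> carrier (homotopy_group n X x0)"
  then show "homotopy_group_map n Y y0 p A \<in> carrier (homotopy_group n Y y0)"
    by (auto simp: carrier_homotopy_group homotopy_group_map_class[OF p] intro: pointed_map_compose[OF _ p])
next
  fix A B assume "A \<in> carrier (homotopy_group n X x0)" "B \<in> carrier (homotopy_group n X x0)"
  then obtain a b where a: "pointed_map (nsphere n) sphere_base X x0 a" "A = sphere_class n X x0 a"
    and b: "pointed_map (nsphere n) sphere_base X x0 b" "B = sphere_class n X x0 b"
    by (auto simp: carrier_homotopy_group)
  have "p \<circ> sphere_concat n a b = sphere_concat n (p \<circ> a) (p \<circ> b)"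
    by (auto simp: sphere_concat_def fun_eq_iff)
  then show "homotopy_group_map n Y y0 p (A \<otimes>\<^bsub>homotopy_group n X x0\<^esub> B)
      = homotopy_group_map n Y y0 p A \<otimes>\<^bsub>homotopy_group n Y y0\<^esub> homotopy_group_map n Y y0 p B"
    using a b pointed_map_sphere_concat[OF n a(1) b(1)]
    by (simp add: mult_homotopy_group[OF n] homotopy_group_map_class[OF p] pointed_map_compose[OF _ p])
qed

context fibre_sequence
begin

lemma connecting_hom_in_carrier:
  assumes "A \<in> carrier (homotopy_group (Suc m) Y y0)"
  shows "connecting_hom (Suc m) Z z0 j X x0 f A \<in> carrier (homotopy_group m Z z0)"
  using exact_at_fibre[of m] assms by blast

text \<open>The pinch map commutes with the suspension coordinate, in which the lift is taken, so the lifts can be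
  concatenated for each value of this coordinate separately.\<close>

lemma boundary_lift_concat:
  assumes m: "m \<ge> 1" and a: "boundary_lift m a H z" and b: "boundary_lift m b K w"
    and base: "a sphere_base = y0" "b sphere_base = y0"
  shows "boundary_lift m (sphere_concat (Suc m) a b)
    (\<lambda>(t, s). if pinch_right m s = sphere_base then H (t, pinch_left m s) else K (t, pinch_right m s))
    (sphere_concat m z w)"
  unfolding boundary_lift_def
proof (intro conjI ballI)
  show "continuous_map (prod_topology interval (nsphere m)) X
      (\<lambda>(t, s). if pinch_right m s = sphere_base then H (t, pinch_left m s) else K (t, pinch_right m s))"
    by (rule continuous_map_pinch_cases[OF m, where ?y0.0 = x0]) (use a b in \<open>auto simp: boundary_lift_def\<close>)
  show "pointed_map (nsphere m) sphere_base Z z0 (sphere_concat m z w)"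
    using a b by (intro pointed_map_sphere_concat[OF m]) (auto simp: boundary_lift_def)
  fix s assume s: "s \<in> topspace (nsphere m)"
  note ps = pinch_in_nsphere[OF m s]
  show "(\<lambda>(t, s). if pinch_right m s = sphere_base then H (t, pinch_left m s) else K (t, pinch_right m s)) (0, s) = x0"
    using a b ps by (simp add: boundary_lift_def)
  show "j (sphere_concat m z w s)
      = (\<lambda>(t, s). if pinch_right m s = sphere_base then H (t, pinch_left m s) else K (t, pinch_right m s)) (1, s)"
    using a b ps by (simp add: boundary_lift_def sphere_concat_def)
  fix t :: real assume t: "t \<in> {0..1}"
  have "sphere_concat (Suc m) a b (sphere_susp m s t)
      = (if pinch_right m s = sphere_base then a (sphere_susp m (pinch_left m s) t)
         else b (sphere_susp m (pinch_right m s) t))"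
    using pinch_wedge[OF m s] base by (auto simp: sphere_concat_def pinch_susp[OF m s t])
  then show "f ((\<lambda>(t, s). if pinch_right m s = sphere_base then H (t, pinch_left m s) else K (t, pinch_right m s)) (t, s))
      = sphere_concat (Suc m) a b (sphere_susp m s t)"
    using a b ps t by (simp add: boundary_lift_def)
next
  fix t :: real assume t: "t \<in> {0..1}"
  show "(\<lambda>(t, s). if pinch_right m s = sphere_base then H (t, pinch_left m s) else K (t, pinch_right m s)) (t, sphere_base) = x0"
    using a t by (simp add: boundary_lift_def pinch_base[OF m])
qed

lemma connecting_hom_hom:
  assumes m: "m \<ge> 1"
  shows "connecting_hom (Suc m) Z z0 j X x0 f \<in> hom (homotopy_group (Suc m) Y y0) (homotopy_group m Z z0)"
proof (rule homI)
  fix A B assume "A \<in> carrier (homotopy_group (Suc m) Y y0)" "B \<in> carrier (homotopy_group (Suc m) Y y0)"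
  then obtain a b where a: "pointed_map (nsphere (Suc m)) sphere_base Y y0 a" "A = sphere_class (Suc m) Y y0 a"
    and b: "pointed_map (nsphere (Suc m)) sphere_base Y y0 b" "B = sphere_class (Suc m) Y y0 b"
    by (auto simp: carrier_homotopy_group)
  obtain H z where Hz: "boundary_lift m a H z" using boundary_lift_exists[OF a(1)] .
  obtain K w where Kw: "boundary_lift m b K w" using boundary_lift_exists[OF b(1)] .
  have "a sphere_base = y0" "b sphere_base = y0" using a(1) b(1) by (simp_all add: pointed_map_def)
  note lift = boundary_lift_concat[OF m Hz Kw this]
  have ab: "pointed_map (nsphere (Suc m)) sphere_base Y y0 (sphere_concat (Suc m) a b)"
    by (rule pointed_map_sphere_concat[OF _ a(1) b(1)]) simp
  have z: "pointed_map (nsphere m) sphere_base Z z0 z" "pointed_map (nsphere m) sphere_base Z z0 w"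
    using Hz Kw by (simp_all add: boundary_lift_def)
  show "connecting_hom (Suc m) Z z0 j X x0 f (A \<otimes>\<^bsub>homotopy_group (Suc m) Y y0\<^esub> B)
      = connecting_hom (Suc m) Z z0 j X x0 f A \<otimes>\<^bsub>homotopy_group m Z z0\<^esub> connecting_hom (Suc m) Z z0 j X x0 f B"
    using a b m z by (simp add: mult_homotopy_group connecting_hom_lift[OF ab lift]
        connecting_hom_lift[OF a(1) Hz] connecting_hom_lift[OF b(1) Kw])
qed (rule connecting_hom_in_carrier)

end


section \<open>Relaxed evaluation subgroups in the exact sequence\<close>

text \<open>The section is the graph of \<open>k\<close>, and the map on the product is the projection to \<open>W\<close> followed by \<open>d\<close>.\<close>

lemma postcomposition_in_relaxed_evaluation_set:
  assumes d: "pointed_map W w0 V v0 d" and k: "pointed_map (nsphere n) sphere_base W w0 k"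
  shows "sphere_class n V v0 (d \<circ> k) \<in> relaxed_evaluation_set n V v0 W w0 d"
proof -
  let ?s = "\<lambda>s. (s, k s)" and ?F = "\<lambda>p. d (snd p)"
  have dk: "pointed_map (nsphere n) sphere_base V v0 (d \<circ> k)" by (rule pointed_map_compose[OF k d])
  have "is_section (nsphere n) sphere_base W w0 ?s"
  proof -
    have "fst \<circ> ?s = id" by auto
    then show ?thesis
      using k by (auto simp: is_section_def pointed_map_def intro!: continuous_map_pairedI)
  qed
  moreover have "pointed_map (prod_topology (nsphere n) W) (sphere_base, w0) V v0 ?F"
    using d continuous_map_compose[OF continuous_map_snd, of W V d "nsphere n"]
    by (simp add: pointed_map_def o_def)
  moreover have "?F \<circ> ?s \<in> sphere_class n V v0 (d \<circ> k)"
    using self_in_sphere_class[OF dk] by (simp add: o_def)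
  moreover have "pointed_homotopic W w0 V v0 (?F \<circ> (\<lambda>x. (sphere_base, x))) d"
    using d by (simp add: o_def)
  ultimately show ?thesis
    using dk unfolding relaxed_evaluation_set_def carrier_homotopy_group by blast
qed

lemma image_in_relaxed_evaluation_set:
  assumes d: "pointed_map W w0 V v0 d"
  shows "homotopy_group_map n V v0 d ` carrier (homotopy_group n W w0) \<subseteq> relaxed_evaluation_set n V v0 W w0 d"
  by (auto simp: carrier_homotopy_group homotopy_group_map_class[OF d]
      intro: postcomposition_in_relaxed_evaluation_set[OF d])

lemma relaxed_evaluation_set_subset:
  "relaxed_evaluation_set n V v0 W w0 d \<subseteq> carrier (homotopy_group n V v0)"
  by (auto simp: relaxed_evaluation_set_def)

text \<open>Only the carrier of the third group shrinks; its multiplication and its unit stay.\<close>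

lemma exact_four_corestrict:
  fixes G1 :: "'b monoid" and G2 :: "'c monoid"
  assumes hom: "h0 \<in> hom G0 G1" "h1 \<in> hom G1 G2" "h2 \<in> hom G2 G3"
    and S: "h1 ` carrier G1 \<subseteq> S" "S \<subseteq> carrier G2"
    and exact: "h0 ` carrier G0 = {x \<in> carrier G1. h1 x = \<one>\<^bsub>G2\<^esub>}"
      "h1 ` carrier G1 = {x \<in> carrier G2. h2 x = \<one>\<^bsub>G3\<^esub>}"
  shows "exact_four G0 h0 G1 h1 (G2\<lparr>carrier := S\<rparr>) h2 G3"
proof -
  have "h1 \<in> hom G1 (G2\<lparr>carrier := S\<rparr>)" using hom(2) S(1) by (auto simp: hom_def)
  moreover have "h2 \<in> hom (G2\<lparr>carrier := S\<rparr>) G3" using hom(3) S(2) by (auto simp: hom_def subset_iff)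
  moreover have "h1 ` carrier G1 = {x \<in> S. h2 x = \<one>\<^bsub>G3\<^esub>}" using exact(2) S by blast
  ultimately show ?thesis using hom(1) exact(1) by (simp add: exact_four_def kernel_def)
qed

context fibre_sequence
begin

text \<open>Every element of \<open>\<pi>\<^sub>0(Z)\<close> is the class of the constant map, so only the product of this class with itself
  has to be computed.\<close>

lemma connecting_hom_hom_0:
  assumes Z: "path_connected_space Z"
  shows "connecting_hom (Suc 0) Z z0 j X x0 f \<in> hom (homotopy_group (Suc 0) Y y0) (homotopy_group 0 Z z0)"
proof (rule homI)
  let ?G = "homotopy_group 0 Z z0"
  have null: "pointed_homotopic (nsphere 0) sphere_base Z z0 (\<lambda>_. z0) g"
    if "pointed_map (nsphere 0) sphere_base Z z0 g" for g
    using path_connected_null_homotopic_0_sphere[OF Z that] .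
  have trivial: "A = sphere_class 0 Z z0 (\<lambda>_. z0)" if "A \<in> carrier ?G" for A
    using that null sphere_class_eqI by (force simp: carrier_homotopy_group)
  fix A B assume AB: "A \<in> carrier (homotopy_group (Suc 0) Y y0)" "B \<in> carrier (homotopy_group (Suc 0) Y y0)"
  have "A \<otimes>\<^bsub>homotopy_group (Suc 0) Y y0\<^esub> B \<in> carrier (homotopy_group (Suc 0) Y y0)"
    using AB by (auto simp: carrier_homotopy_group mult_homotopy_group intro!: imageI pointed_map_sphere_concat)
  note images = this[THEN connecting_hom_in_carrier, THEN trivial]
    AB(1)[THEN connecting_hom_in_carrier, THEN trivial] AB(2)[THEN connecting_hom_in_carrier, THEN trivial]
  have "sphere_class 0 Z z0 (\<lambda>_. z0) \<otimes>\<^bsub>?G\<^esub> sphere_class 0 Z z0 (\<lambda>_. z0) = sphere_class 0 Z z0 (\<lambda>_. z0)"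
    (is "?L = ?R")
  proof (intro equalityI subsetI)
    fix g assume "g \<in> ?L"
    then obtain c where "g \<in> sphere_class 0 Z z0 c" by (auto simp: homotopy_group_def)
    then have "pointed_map (nsphere 0) sphere_base Z z0 g"
      by (auto simp: sphere_class_def dest: pointed_homotopic_imp_pointed_map(2))
    then show "g \<in> ?R" using null by (simp add: sphere_class_def)
  next
    fix g assume "g \<in> ?R"
    moreover have "is_concat 0 (\<lambda>_. z0) (\<lambda>_. z0) (\<lambda>_. z0)" by (simp add: is_concat_def)
    moreover have "(\<lambda>_. z0) \<in> sphere_class 0 Z z0 (\<lambda>_. z0)" by (simp add: sphere_class_def)
    ultimately show "g \<in> ?L" unfolding homotopy_group_def by auto
  qed
  then show "connecting_hom (Suc 0) Z z0 j X x0 f (A \<otimes>\<^bsub>homotopy_group (Suc 0) Y y0\<^esub> B)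
    = connecting_hom (Suc 0) Z z0 j X x0 f A \<otimes>\<^bsub>?G\<^esub> connecting_hom (Suc 0) Z z0 j X x0 f B"
    by (simp only: images)
qed (rule connecting_hom_in_carrier)

text \<open>Composing the homotopy that characterizes \<open>d\<close> with the adjoint of \<open>a\<close> gives the homotopy that characterizes
  the boundary of \<open>[a]\<close>.\<close>

lemma connecting_hom_eq_connecting_map:
  assumes d: "connecting_map Z z0 j X x0 f Y y0 d" and a: "pointed_map (nsphere (Suc m)) sphere_base Y y0 a"
  shows "connecting_hom (Suc m) Z z0 j X x0 f (sphere_class (Suc m) Y y0 a) = sphere_class m Z z0 (d \<circ> susp_adjoint m a)"
proof -
  note adj = pointed_map_susp_adjoint[OF a]
  have "pointed_map (nsphere m) sphere_base Z z0 (d \<circ> susp_adjoint m a)"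
    using d by (auto simp: connecting_map_def intro: pointed_map_compose[OF adj])
  moreover have "pointed_homotopic (nsphere m) sphere_base hofib (x0, const_path y0)
      (\<lambda>s. (j ((d \<circ> susp_adjoint m a) s), const_path y0)) (\<lambda>s. (x0, susp_adjoint m a s))"
    using pointed_homotopic_precompose[OF _ adj] d by (fastforce simp: connecting_map_def o_def)
  ultimately show ?thesis using connecting_hom_eq_class_iff[OF a] by blast
qed

end

theorem corollary1p3:
  fixes Z :: "'z topology" and X :: "'x topology" and Y :: "'y topology"
    and KZ :: "'kz topology" and KX :: "'kx topology" and KY :: "'ky topology"
    and z0 :: 'z and x0 :: 'x and y0 :: 'y
    and j :: "'z \<Rightarrow> 'x" and f :: "'x \<Rightarrow> 'y"
    and n :: nat
  assumes "CW_complex KZ" and "Z homotopy_equivalent_space KZ" and "connected_space Z"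
    and "CW_complex KX" and "X homotopy_equivalent_space KX" and "connected_space X"
    and "CW_complex KY" and "Y homotopy_equivalent_space KY" and "connected_space Y"
    and "fibration_sequence Z z0 j X x0 f Y y0"
    and "n \<ge> 1"
  shows
    "exact_four
       (homotopy_group (n + 1) Y y0) (connecting_hom (n + 1) Z z0 j X x0 f)
       (homotopy_group n Z z0) (homotopy_group_map n X x0 j)
       (relaxed_evaluation_group n X x0 Z z0 j) (homotopy_group_map n Y y0 f)
       (homotopy_group n Y y0)
     \<and>
     exact_four
       (homotopy_group n Z z0) (homotopy_group_map n X x0 j)
       (homotopy_group n X x0) (homotopy_group_map n Y y0 f)
       (relaxed_evaluation_group n Y y0 X x0 f) (connecting_hom n Z z0 j X x0 f)
       (homotopy_group (n - 1) Z z0)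
     \<and>
     (\<forall>d. connecting_map Z z0 j X x0 f Y y0 d \<longrightarrow>
       exact_four
         (homotopy_group (n + 1) X x0) (homotopy_group_map (n + 1) Y y0 f)
         (homotopy_group (n + 1) Y y0) (connecting_hom (n + 1) Z z0 j X x0 f)
         (relaxed_evaluation_group n Z z0 (loop_space Y y0) (const_path y0) d)
         (homotopy_group_map n X x0 j)
         (homotopy_group n X x0))"
proof -
  interpret fibre_sequence Z z0 j X x0 f Y y0 by unfold_locales fact
  have n: "n \<ge> 1" by fact
  obtain m where m: "n = Suc m" using n by (cases n) auto
  note homs = homotopy_group_map_hom[OF _ pointed_map_j] homotopy_group_map_hom[OF _ pointed_map_f]
  have Z: "path_connected_space Z"
    by (rule path_connected_of_CW_homotopy_type) fact+
  have low: "connecting_hom n Z z0 j X x0 f \<in> hom (homotopy_group n Y y0) (homotopy_group (n - 1) Z z0)"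
    using connecting_hom_hom[of m] connecting_hom_hom_0[OF Z] by (cases "m = 0") (simp_all add: m)
  have 1: "exact_four (homotopy_group (n + 1) Y y0) (connecting_hom (n + 1) Z z0 j X x0 f)
      (homotopy_group n Z z0) (homotopy_group_map n X x0 j)
      (relaxed_evaluation_group n X x0 Z z0 j) (homotopy_group_map n Y y0 f) (homotopy_group n Y y0)"
    unfolding relaxed_evaluation_group_def
    using n by (intro exact_four_corestrict image_in_relaxed_evaluation_set relaxed_evaluation_set_subset)
      (simp_all add: homs connecting_hom_hom pointed_map_j exact_at_fibre exact_at_total_space one_homotopy_group)
  have 2: "exact_four (homotopy_group n Z z0) (homotopy_group_map n X x0 j)
      (homotopy_group n X x0) (homotopy_group_map n Y y0 f)
      (relaxed_evaluation_group n Y y0 X x0 f) (connecting_hom n Z z0 j X x0 f) (homotopy_group (n - 1) Z z0)"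
    unfolding relaxed_evaluation_group_def
  proof (intro exact_four_corestrict image_in_relaxed_evaluation_set relaxed_evaluation_set_subset)
    show "homotopy_group_map n Y y0 f ` carrier (homotopy_group n X x0)
        = {A \<in> carrier (homotopy_group n Y y0). connecting_hom n Z z0 j X x0 f A = \<one>\<^bsub>homotopy_group (n - 1) Z z0\<^esub>}"
      using exact_at_base[of m] by (simp add: m one_homotopy_group)
  qed (use n low in \<open>simp_all add: homs pointed_map_f exact_at_total_space one_homotopy_group\<close>)
  have 3: "exact_four (homotopy_group (n + 1) X x0) (homotopy_group_map (n + 1) Y y0 f)
      (homotopy_group (n + 1) Y y0) (connecting_hom (n + 1) Z z0 j X x0 f)
      (relaxed_evaluation_group n Z z0 (loop_space Y y0) (const_path y0) d)
      (homotopy_group_map n X x0 j) (homotopy_group n X x0)"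
    if d: "connecting_map Z z0 j X x0 f Y y0 d" for d
    unfolding relaxed_evaluation_group_def
  proof (intro exact_four_corestrict relaxed_evaluation_set_subset)
    have "pointed_map (loop_space Y y0) (const_path y0) Z z0 d" using d by (simp add: connecting_map_def)
    note in_evaluation_set = postcomposition_in_relaxed_evaluation_set[OF this pointed_map_susp_adjoint]
    show "connecting_hom (n + 1) Z z0 j X x0 f ` carrier (homotopy_group (n + 1) Y y0)
        \<subseteq> relaxed_evaluation_set n Z z0 (loop_space Y y0) (const_path y0) d"
      by (auto simp: carrier_homotopy_group connecting_hom_eq_connecting_map[OF d] in_evaluation_set)
  qed (use n in \<open>simp_all add: homs connecting_hom_hom exact_at_base exact_at_fibre one_homotopy_group\<close>)
  show ?thesis using 1 2 3 by blast
qed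

end
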